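(* Let $\alpha\ge 1$ and let $\mathcal{A}$ be an $\alpha$-approximation algorithm for wMIS on weighted $\{2,3\}$-intersection graphs. Then the algorithm MaxLeaves-12MIS that uses $\mathcal{A}$ as its independent-set subroutine is a $\max\{\frac43,\alpha\}$-approximation algorithm for the Maximum Leaf Spanning Arborescence problem on rooted directed acyclic graphs.
   Context: Digraphs: a node $r$ of a digraph $D$ is a root if $D$ has a directed path from $r$ to every node; $D$ is rooted if it has a root. A dag is a digraph with no directed cycle. An arborescence is an $r$-rooted digraph with a unique directed path from $r$ to every node. A branching is a collection of vertex-disjoint arborescences; it is spanning if it contains every node of $D$. A leaf of a branching is a node of out-degree 0. Maximum Leaf Spanning Arborescence: given a rooted digraph $D$, find a spanning arborescence of $D$ with maximum number of leaves. For $\beta\ge1$, a $\beta$-approximation algorithm for a maximization problem runs in polynomial time and outputs a feasible solution of value at least $1/\beta$ times the optimum. Weighted $\{2,3\}$-intersection graphs: a hereditary $\{2,3\}$-collection is $(V,U)$ with $V$ finite, $U=\{U_v:v\in V\}$ sets of size 2 or 3, such that for each $v$ with $U_v=\{a,b,c\}$ there are $v_a,v_b,v_c\in V$ with $U_{v_a}=\{b,c\},U_{v_b}=\{a,c\},U_{v_c}=\{a,b\}$; its weighted $\{2,3\}$-intersection graph is the multigraph on $V$ with $|U_x\cap U_y|$ parallel edges between distinct $x,y$, with weights $w_v=|U_v|-1$. wMIS: find an independent set maximizing the total weight. GreedyExpand$(D,t,F)$ (input: rooted dag $D$, integer $t\ge1$, spanning branching $F$): set $F'\leftarrow F$; go through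 the nodes $v$ of $D$ in arbitrary order, and for each $v$ with out-degree 0 in the current $F'$, let $A_v$ be the set of arcs $vu$ of $D$ such that $u$ has in-degree 0 in $F'$; if $|A_v|\ge t$, add the arcs $A_v$ to $F'$. Return $F'$. MaxLeaves-12MIS$(D)$ (input: rooted dag $D$): (1) $F_0$ := spanning branching with no arcs; $F_1$ := GreedyExpand$(D,4,F_0)$. (2) For each node $v$ with out-degree 0 in $F_1$, let $U_v$ be the set of nodes $u$ with in-degree 0 in $F_1$ and $vu$ an arc of $D$. (3) Candidates := the set of nodes $v$ with out-degree 0 in $F_1$ and $2\le|U_v|\le3$; for each such $v$ with $|U_v|=3$ and each $u\in U_v$, add to Candidates a new element $v_u$ with $U_{v_u}=U_v\setminus\{u\}$, whose underlying node is $v$ (a node $v$ in Candidates is its own underlying node). (4) Let $G$ be the intersection multigraph of $(\text{Candidates},U)$ with weights $w_x=|U_x|-1$ (a weighted $\{2,3\}$-intersection graph). (5) $I$ := the independent set returned by the wMIS subroutine on $(G,w)$. (6) $F_2$ := $F_1$ plus, for each $x\in I$ with underlying node $v$, the arcs $\{vu:u\in U_x\}$. (7) Return $T$ := GreedyExpand$(D,1,F_2)$.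
   Formalization: As stated, the output may fail to span when α>1. Proved instead: the ratio holds for the literal algorithm if no single-vertex swap for a heavier vertex improves 𝒜's set, and for every 𝒜 if each node left without an entering arc, but having one in D, is finally given one. *)

theory Defs
  imports "Graph_Theory.Graph_Theory" "HOL-Computational_Algebra.Polynomial"
begin

section \<open>A machine model for polynomial time\<close>

text \<open>
  Programs transform one binary tree. The cost of every construct is one plus the size of the
  value it is applied to, so values are charged as if copied explicitly (no sharing). In particular
  the size of a result is at most the size of the argument plus the cost, and the model is
  equivalent to Turing machines up to polynomial overhead (a tape is a pair of stacks).
  In both \<open>Cond\<close> and \<open>Loop\<close>, \<open>Empty\<close> counts as false. \<open>Left\<close> and \<open>Right\<close> are total.
\<close>

datatype val = Empty | Join val val

datatype prog =
    Identity
  | Const_Empty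
  | Left
  | Right
  | Fork prog prog
  | Then prog prog
  | Cond prog prog prog
  | Loop prog prog

inductive exec :: "prog \<Rightarrow> val \<Rightarrow> val \<Rightarrow> nat \<Rightarrow> bool" where
  Identity: "exec Identity x x (1 + size x)"
| Const_Empty: "exec Const_Empty x Empty (1 + size x)"
| Left_Empty: "exec Left Empty Empty (1 + size Empty)"
| Left_Join: "exec Left (Join a b) a (1 + size (Join a b))"
| Right_Empty: "exec Right Empty Empty (1 + size Empty)"
| Right_Join: "exec Right (Join a b) b (1 + size (Join a b))"
| Fork: "exec p x y s \<Longrightarrow> exec q x z t \<Longrightarrow> exec (Fork p q) x (Join y z) (1 + size x + s + t)"
| Then: "exec p x y s \<Longrightarrow> exec q y z t \<Longrightarrow> exec (Then p q) x z (1 + size x + s + t)"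
| Cond_true: "exec c x b s \<Longrightarrow> b \<noteq> Empty \<Longrightarrow> exec p x y t \<Longrightarrow>
    exec (Cond c p q) x y (1 + size x + s + t)"
| Cond_false: "exec c x Empty s \<Longrightarrow> exec q x y t \<Longrightarrow> exec (Cond c p q) x y (1 + size x + s + t)"
| Loop_stop: "exec c x Empty s \<Longrightarrow> exec (Loop c p) x x (1 + size x + s)"
| Loop_step: "exec c x b s \<Longrightarrow> b \<noteq> Empty \<Longrightarrow> exec p x y t \<Longrightarrow> exec (Loop c p) y z u \<Longrightarrow>
    exec (Loop c p) x z (1 + size x + s + t + u)"

primrec code_nat :: "nat \<Rightarrow> val" where
  "code_nat 0 = Empty"
| "code_nat (Suc n) = Join Empty (code_nat n)"

primrec code_list :: "val list \<Rightarrow> val" where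
  "code_list [] = Empty"
| "code_list (x # xs) = Join x (code_list xs)"

text \<open>
  A finite set is presented to a program by an enumeration \<open>xs\<close>; only positions in \<open>xs\<close> are
  visible to the program, never the elements themselves. Unary numbers are harmless, since all the
  numbers to be encoded are at most 3.
\<close>

definition enumerates :: "'v list \<Rightarrow> 'v set \<Rightarrow> bool" where
  "enumerates xs S \<longleftrightarrow> distinct xs \<and> set xs = S"

definition code_vector :: "'v list \<Rightarrow> ('v \<Rightarrow> nat) \<Rightarrow> val" where
  "code_vector xs f = code_list (map (\<lambda>x. code_nat (f x)) xs)"

definition code_matrix :: "'v list \<Rightarrow> ('v \<Rightarrow> 'v \<Rightarrow> nat) \<Rightarrow> val" where
  "code_matrix xs f = code_list (map (\<lambda>x. code_vector xs (f x)) xs)"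

definition code_subset :: "'v list \<Rightarrow> 'v set \<Rightarrow> val" where
  "code_subset xs S = code_vector xs (\<lambda>x. of_bool (x \<in> S))"

definition code_digraph :: "'v list \<Rightarrow> 'v pair_pre_digraph \<Rightarrow> val" where
  "code_digraph xs D = code_matrix xs (\<lambda>u v. of_bool ((u, v) \<in> parcs D))"


section \<open>Maximization problems and approximation algorithms\<close>

record ('i, 's) maximization_problem =
  instances :: "'i set"
  feasible :: "'i \<Rightarrow> 's set"
  objective :: "'i \<Rightarrow> 's \<Rightarrow> real"
  code_input :: "'i \<Rightarrow> val"
  code_output :: "'i \<Rightarrow> 's \<Rightarrow> val"

definition optimum :: "('i, 's) maximization_problem \<Rightarrow> 'i \<Rightarrow> real" where
  "optimum Q i = Max (objective Q i ` feasible Q i)"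

definition approximates :: "real \<Rightarrow> ('i, 's) maximization_problem \<Rightarrow> 'i \<Rightarrow> 's \<Rightarrow> bool" where
  "approximates \<beta> Q i s \<longleftrightarrow> s \<in> feasible Q i \<and> objective Q i s \<ge> (1 / \<beta>) * optimum Q i"

definition approximation_program ::
    "real \<Rightarrow> ('i, 's) maximization_problem \<Rightarrow> prog \<Rightarrow> bool" where
  "approximation_program \<beta> Q P \<longleftrightarrow>
     (\<exists>p :: nat poly. \<forall>i \<in> instances Q. \<exists>s t.
        approximates \<beta> Q i s \<and>
        exec P (code_input Q i) (code_output Q i s) t \<and>
        t \<le> poly p (size (code_input Q i)))"

text \<open>
  Pseudocode that leaves choices open (such as the order in which nodes are visited) is modelled by
  the relation \<open>R\<close> between instances and the results of all its possible executions. Every such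
  result has to be good, and some program has to carry out an execution in polynomial time.
\<close>

definition approximation_algorithm ::
    "real \<Rightarrow> ('i, 's) maximization_problem \<Rightarrow> ('i \<Rightarrow> 's \<Rightarrow> bool) \<Rightarrow> bool" where
  "approximation_algorithm \<beta> Q R \<longleftrightarrow>
     (\<forall>i \<in> instances Q. \<forall>s. R i s \<longrightarrow> approximates \<beta> Q i s) \<and>
     (\<exists>P. \<exists>p :: nat poly. \<forall>i \<in> instances Q. \<exists>s t.
        R i s \<and>
        exec P (code_input Q i) (code_output Q i s) t \<and>
        t \<le> poly p (size (code_input Q i)))"


section \<open>Maximum leaf spanning arborescences of rooted dags\<close>

definition root :: "'a pair_pre_digraph \<Rightarrow> 'a \<Rightarrow> bool" where
  "root D r \<longleftrightarrow> r \<in> pverts D \<and> (\<forall>v \<in> pverts D. \<exists>p. pre_digraph.apath D r p v)"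

definition dag :: "'a pair_pre_digraph \<Rightarrow> bool" where
  "dag D \<longleftrightarrow> \<not> (\<exists>p. pre_digraph.cycle D p)"

definition rooted_dag :: "'a pair_pre_digraph \<Rightarrow> bool" where
  "rooted_dag D \<longleftrightarrow> pair_fin_digraph D \<and> dag D \<and> (\<exists>r. root D r)"

definition arborescence :: "'a pair_pre_digraph \<Rightarrow> bool" where
  "arborescence T \<longleftrightarrow> pair_fin_digraph T \<and>
     (\<exists>r. root T r \<and> (\<forall>v \<in> pverts T. \<exists>!p. pre_digraph.apath T r p v))"

definition leaves :: "'a pair_pre_digraph \<Rightarrow> 'a set" where
  "leaves F = {v \<in> pverts F. out_degree F v = 0}"

definition max_leaf_spanning_arborescence ::
    "('a list \<times> 'a pair_pre_digraph, 'a pair_pre_digraph) maximization_problem" where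
  "max_leaf_spanning_arborescence = \<lparr>
     instances = {(vs, D). rooted_dag D \<and> enumerates vs (pverts D)},
     feasible = (\<lambda>(vs, D). {T. arborescence T \<and> spanning T D}),
     objective = (\<lambda>(vs, D) T. real (card (leaves T))),
     code_input = (\<lambda>(vs, D). code_digraph vs D),
     code_output = (\<lambda>(vs, D) T. code_digraph vs T)\<rparr>"


section \<open>Independent sets in weighted \<open>{2,3}\<close>-intersection graphs\<close>

record 'v weighted_multigraph =
  wverts :: "'v set"
  multiplicity :: "'v \<Rightarrow> 'v \<Rightarrow> nat"
  weight :: "'v \<Rightarrow> nat"

definition hereditary_23_collection :: "'v set \<Rightarrow> ('v \<Rightarrow> 'e set) \<Rightarrow> bool" where
  "hereditary_23_collection V U \<longleftrightarrow> finite V \<and>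
     (\<forall>v \<in> V. card (U v) = 2 \<or> card (U v) = 3) \<and>
     (\<forall>v \<in> V. \<forall>a b c. card (U v) = 3 \<and> U v = {a, b, c} \<longrightarrow>
        (\<exists>v\<^sub>a \<in> V. \<exists>v\<^sub>b \<in> V. \<exists>v\<^sub>c \<in> V. U v\<^sub>a = {b, c} \<and> U v\<^sub>b = {a, c} \<and> U v\<^sub>c = {a, b}))"

definition intersection_graph :: "'v set \<Rightarrow> ('v \<Rightarrow> 'e set) \<Rightarrow> 'v weighted_multigraph" where
  "intersection_graph V U = \<lparr>
     wverts = V,
     multiplicity = (\<lambda>x y. if x = y then 0 else card (U x \<inter> U y)),
     weight = (\<lambda>v. card (U v) - 1)\<rparr>"

text \<open>Finitely many finite sets can always be taken to be sets of natural numbers.\<close>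

definition weighted_23_intersection_graph :: "'v weighted_multigraph \<Rightarrow> bool" where
  "weighted_23_intersection_graph G \<longleftrightarrow>
     (\<exists>V. \<exists>U :: 'v \<Rightarrow> nat set. hereditary_23_collection V U \<and> G = intersection_graph V U)"

definition independent :: "'v weighted_multigraph \<Rightarrow> 'v set \<Rightarrow> bool" where
  "independent G I \<longleftrightarrow> I \<subseteq> wverts G \<and> (\<forall>x \<in> I. \<forall>y \<in> I. x \<noteq> y \<longrightarrow> multiplicity G x y = 0)"

definition code_weighted_multigraph :: "'v list \<Rightarrow> 'v weighted_multigraph \<Rightarrow> val" where
  "code_weighted_multigraph xs G = Join (code_vector xs (weight G)) (code_matrix xs (multiplicity G))"

definition wMIS :: "('v list \<times> 'v weighted_multigraph, 'v set) maximization_problem" where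
  "wMIS = \<lparr>
     instances = {(xs, G). weighted_23_intersection_graph G \<and> enumerates xs (wverts G)},
     feasible = (\<lambda>(xs, G). {I. independent G I}),
     objective = (\<lambda>(xs, G) I. real (\<Sum>x\<in>I. weight G x)),
     code_input = (\<lambda>(xs, G). code_weighted_multigraph xs G),
     code_output = (\<lambda>(xs, G) I. code_subset xs I)\<rparr>"

definition returns_set :: "prog \<Rightarrow> 'v list \<Rightarrow> 'v weighted_multigraph \<Rightarrow> 'v set \<Rightarrow> bool" where
  "returns_set A xs G I \<longleftrightarrow> I \<subseteq> wverts G \<and>
     (\<exists>t. exec A (code_weighted_multigraph xs G) (code_subset xs I) t)"


section \<open>The algorithm MaxLeaves-12MIS\<close>

text \<open>The set \<open>U\<^sub>v\<close>; the heads of the arcs in \<open>A\<^sub>v\<close>.\<close>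

definition free_heads :: "'a pair_pre_digraph \<Rightarrow> 'a pair_pre_digraph \<Rightarrow> 'a \<Rightarrow> 'a set" where
  "free_heads D F v = {u. (v, u) \<in> parcs D \<and> in_degree F u = 0}"

definition greedy_step ::
    "'a pair_pre_digraph \<Rightarrow> nat \<Rightarrow> 'a \<Rightarrow> 'a pair_pre_digraph \<Rightarrow> 'a pair_pre_digraph" where
  "greedy_step D t v F =
     (let A = {(v, u) | u. u \<in> free_heads D F v} in
      if out_degree F v = 0 \<and> card A \<ge> t then F\<lparr>parcs := parcs F \<union> A\<rparr> else F)"

definition greedy_expand ::
    "'a pair_pre_digraph \<Rightarrow> nat \<Rightarrow> 'a list \<Rightarrow> 'a pair_pre_digraph \<Rightarrow> 'a pair_pre_digraph" where
  "greedy_expand D t vs F = fold (greedy_step D t) vs F"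

text \<open>
  A candidate is a pair whose first component is the underlying node: \<open>(v, None)\<close> stands for the
  node \<open>v\<close> itself, and \<open>(v, Some u)\<close> for the new element \<open>v\<^sub>u\<close>.
\<close>

type_synonym 'a candidate = "'a \<times> 'a option"

definition candidates ::
    "'a pair_pre_digraph \<Rightarrow> 'a pair_pre_digraph \<Rightarrow> 'a candidate set" where
  "candidates D F =
     {(v, None) | v. v \<in> pverts D \<and> out_degree F v = 0 \<and>
        2 \<le> card (free_heads D F v) \<and> card (free_heads D F v) \<le> 3} \<union>
     {(v, Some u) | v u. v \<in> pverts D \<and> out_degree F v = 0 \<and>
        card (free_heads D F v) = 3 \<and> u \<in> free_heads D F v}"

fun candidate_set ::
    "'a pair_pre_digraph \<Rightarrow> 'a pair_pre_digraph \<Rightarrow> 'a candidate \<Rightarrow> 'a set" where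
  "candidate_set D F (v, None) = free_heads D F v"
| "candidate_set D F (v, Some u) = free_heads D F v - {u}"

definition maxleaves_12MIS ::
    "prog \<Rightarrow> 'a pair_pre_digraph \<Rightarrow> 'a pair_pre_digraph \<Rightarrow> bool" where
  "maxleaves_12MIS A D T \<longleftrightarrow>
     (\<exists>vs\<^sub>1 vs\<^sub>2 xs I F\<^sub>0 F\<^sub>1 F\<^sub>2 G.
        enumerates vs\<^sub>1 (pverts D) \<and>
        enumerates vs\<^sub>2 (pverts D) \<and>
        F\<^sub>0 = \<lparr>pverts = pverts D, parcs = {}\<rparr> \<and>
        F\<^sub>1 = greedy_expand D 4 vs\<^sub>1 F\<^sub>0 \<and>
        G = intersection_graph (candidates D F\<^sub>1) (candidate_set D F\<^sub>1) \<and>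
        enumerates xs (wverts G) \<and>
        returns_set A xs G I \<and>
        F\<^sub>2 = F\<^sub>1\<lparr>parcs := parcs F\<^sub>1 \<union> {(fst x, u) | x u. x \<in> I \<and> u \<in> candidate_set D F\<^sub>1 x}\<rparr> \<and>
        T = greedy_expand D 1 vs\<^sub>2 F\<^sub>2)"

text \<open>
  The result of MaxLeaves-12MIS need not be connected: if \<open>D\<close> consists of the arcs \<open>va\<close>, \<open>vb\<close>,
  \<open>vc\<close> and the subroutine returns \<open>{v\<^sub>a}\<close> (of weight 1, the optimum being 2), then the final
  GreedyExpand skips \<open>v\<close>, which has out-degree 2, and \<open>a\<close> stays isolated. There are two ways around
  this. Either every node that is left without an entering arc although it has one in \<open>D\<close> finally
  gets one; this changes nothing if the result is already a spanning arborescence of a dag.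
  Or the subroutine never returns a set that can be improved by exchanging one vertex for a
  heavier one, as holds in particular for exact algorithms.
\<close>

definition completes ::
    "'a pair_pre_digraph \<Rightarrow> 'a pair_pre_digraph \<Rightarrow> 'a pair_pre_digraph \<Rightarrow> bool" where
  "completes D T T' \<longleftrightarrow>
     (let W = {u. in_degree T u = 0 \<and> in_degree D u > 0} in
      \<exists>h. (\<forall>u \<in> W. (h u, u) \<in> parcs D) \<and> T' = T\<lparr>parcs := parcs T \<union> {(h u, u) | u. u \<in> W}\<rparr>)"

definition maxleaves_12MIS_completed ::
    "prog \<Rightarrow> 'a pair_pre_digraph \<Rightarrow> 'a pair_pre_digraph \<Rightarrow> bool" where
  "maxleaves_12MIS_completed A D T' \<longleftrightarrow> (\<exists>T. maxleaves_12MIS A D T \<and> completes D T T')"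

definition exchange_optimal :: "prog \<Rightarrow> bool" where
  "exchange_optimal A \<longleftrightarrow>
     (\<forall>(xs :: nat list, G) \<in> instances wMIS. \<forall>I. returns_set A xs G I \<longrightarrow>
        (\<forall>x \<in> I. \<forall>y \<in> wverts G - I. independent G (insert y (I - {x})) \<longrightarrow> weight G y \<le> weight G x))"

end

theory Submission
  imports Defs
begin

text \<open>
  Let \<open>k\<close> nodes have been expanded in \<open>F\<^sub>1\<close>, which has \<open>N \<ge> 4 k\<close> arcs, and let \<open>w\<close> denote total
  weight. Each expansion of the last GreedyExpand covers a new node, so counting arcs shows that the
  result has at least \<open>1 + N - k + w(I) \<ge> 1 + 3 N / 4 + w(I)\<close> leaves. In \<open>F\<^sub>1\<close> no expanded node has a
  free head and no other node has more than three. Hence in any spanning arborescence the sets of at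
  least two uncovered children of a common node are candidate sets. They form an independent
  set \<open>J\<close>, and the arborescence has at most \<open>1 + N + w(J)\<close> leaves.

  A node that stays uncovered has only expanded in-neighbours, so attaching it costs no leaf. It can
  only be the element \<open>u\<close> missing from a selected candidate \<open>v\<^sub>u\<close>, and then exchanging \<open>v\<^sub>u\<close> for \<open>v\<close>
  increases the weight.
\<close>

section \<open>Polynomial-time programs\<close>

text \<open>The threshold 4 of the first pass serves both sides of the comparison: an expansion
  gives up one leaf for at least four covered nodes, which is where 3/4 comes from, and afterwards
  at most three heads are free anywhere, so sets of size 2 and 3 suffice. Heredity is there because
  an arborescence may use only two of three free heads. Much of the length is due to the running
  time. Polynomial time means an actual program of the tree machine, and the subroutine is known
  only through its behaviour on graphs whose vertices are natural numbers. Closure properties of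
  total functions replace programming; the subroutine, which may be slow or diverge on trees that
  are not codes, is inserted just once. Its guarantees reach candidate graphs because renaming
  vertices does not change the code and execution is deterministic, so the set returned corresponds
  to one that the guarantees speak about.\<close>

lemma exec_deterministic:
  "exec P x y t \<Longrightarrow> exec P x y' t' \<Longrightarrow> y = y' \<and> t = t'"
proof (induction arbitrary: y' t' rule: exec.induct)
  case (Fork p x y s q z t)
  from Fork.prems Fork.IH show ?case by (cases rule: exec.cases) blast+
next
  case (Then p x y s q z t)
  from Then.prems Then.IH show ?case by (cases rule: exec.cases) blast+
next
  case (Cond_true c x b s p y t q)
  from Cond_true.prems Cond_true.IH Cond_true.hyps show ?case by (cases rule: exec.cases) blast+
next
  case (Cond_false c x s q y t p)
  from Cond_false.prems Cond_false.IH show ?case by (cases rule: exec.cases) blast+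
next
  case (Loop_stop c x s p)
  from Loop_stop.prems Loop_stop.IH show ?case by (cases rule: exec.cases) blast+
next
  case (Loop_step c x b s p y t z u)
  from Loop_step.prems Loop_step.IH Loop_step.hyps show ?case by (cases rule: exec.cases) blast+
qed (auto elim: exec.cases)

text \<open>Every construct is charged for the value it is applied to, so growth is paid for. Time
  bounds thereby yield size bounds, on which composition and loops rely.\<close>

lemma exec_size: "exec P x y t \<Longrightarrow> size y \<le> size x + t"
  by (induction rule: exec.induct) auto

section \<open>Polynomial bounds with natural coefficients\<close>

lemma poly_nat_mono: "m \<le> n \<Longrightarrow> poly p m \<le> poly p n" for p :: "nat poly"
  by (induction p) (auto intro!: mult_mono add_mono)

text \<open>The polynomial is hidden behind an existential, so that time expressions assembled along
  a program can be bounded by introduction rules alone.\<close>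

definition poly_bounded :: "('i \<Rightarrow> nat) \<Rightarrow> ('i \<Rightarrow> nat) \<Rightarrow> bool" where
  "poly_bounded m f \<longleftrightarrow> (\<exists>p :: nat poly. \<forall>i. f i \<le> poly p (m i))"

lemma poly_bounded_const: "poly_bounded m (\<lambda>_. k)"
  unfolding poly_bounded_def by (rule exI[of _ "[:k:]"]) simp

lemma poly_bounded_id: "poly_bounded m m"
  unfolding poly_bounded_def by (rule exI[of _ "[:0, 1:]"]) simp

lemma poly_bounded_add:
  assumes "poly_bounded m f" "poly_bounded m g"
  shows "poly_bounded m (\<lambda>i. f i + g i)"
proof -
  obtain p q where "f i \<le> poly p (m i)" "g i \<le> poly q (m i)" for i
    using assms unfolding poly_bounded_def by auto
  then show ?thesis
    unfolding poly_bounded_def by (intro exI[of _ "p + q"]) (simp add: add_mono)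
qed

lemma poly_bounded_mult:
  assumes "poly_bounded m f" "poly_bounded m g"
  shows "poly_bounded m (\<lambda>i. f i * g i)"
proof -
  obtain p q where "f i \<le> poly p (m i)" "g i \<le> poly q (m i)" for i
    using assms unfolding poly_bounded_def by auto
  then show ?thesis
    unfolding poly_bounded_def by (intro exI[of _ "p * q"]) (simp add: mult_mono)
qed

lemma poly_bounded_poly:
  fixes p :: "nat poly"
  assumes "poly_bounded m f"
  shows "poly_bounded m (\<lambda>i. poly p (f i))"
proof -
  obtain q where "f i \<le> poly q (m i)" for i
    using assms unfolding poly_bounded_def by auto
  then show ?thesis
    unfolding poly_bounded_def
    by (intro exI[of _ "pcompose p q"]) (simp add: poly_pcompose poly_nat_mono)
qed

lemma poly_bounded_mono: "poly_bounded m g \<Longrightarrow> (\<And>i. f i \<le> g i) \<Longrightarrow> poly_bounded m f"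
  unfolding poly_bounded_def by (meson le_trans)

lemmas poly_bounded_intros =
  poly_bounded_const poly_bounded_id poly_bounded_add poly_bounded_mult poly_bounded_poly

text \<open>The program has to halt in polynomial time on every tree, not only on codes. This keeps
  composition free of side conditions; in return, the functions treated this way are total on
  trees.\<close>

definition ptime :: "(val \<Rightarrow> val) \<Rightarrow> bool" where
  "ptime f \<longleftrightarrow> (\<exists>P. \<exists>p :: nat poly. \<forall>x. \<exists>t. exec P x (f x) t \<and> t \<le> poly p (size x))"

lemma ptimeE:
  assumes "ptime f"
  obtains P T where "\<And>x. exec P x (f x) (T x)" "poly_bounded size T"
proof -
  from assms obtain P p where *: "\<forall>x. \<exists>t. exec P x (f x) t \<and> t \<le> poly p (size x)"
    unfolding ptime_def by blast
  then obtain T where "\<forall>x. exec P x (f x) (T x) \<and> T x \<le> poly p (size x)"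
    by metis
  then show ?thesis using that unfolding poly_bounded_def by blast
qed

lemma ptimeI:
  assumes "\<And>x. exec P x (f x) (T x)" "poly_bounded size T"
  shows "ptime f"
  using assms unfolding ptime_def poly_bounded_def by blast

lemma ptime_size:
  assumes "ptime f"
  shows "poly_bounded size (\<lambda>x. size (f x))"
proof -
  obtain P T where P: "\<And>x. exec P x (f x) (T x)" and T: "poly_bounded size T"
    using assms by (rule ptimeE) blast
  have "poly_bounded size (\<lambda>x. size x + T x)"
    by (intro poly_bounded_intros T)
  then show ?thesis
    by (rule poly_bounded_mono) (use P exec_size in blast)
qed

section \<open>Closure under the basic constructs\<close>

primrec left :: "val \<Rightarrow> val" where
  "left Empty = Empty"
| "left (Join a b) = a"

primrec right :: "val \<Rightarrow> val" where
  "right Empty = Empty"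
| "right (Join a b) = b"

lemma size_right: "size (right x) \<le> size x"
  by (cases x) auto

lemma exec_Left: "exec Left x (left x) (1 + size x)"
  by (cases x) (simp_all del: val.size One_nat_def add: exec.intros)

lemma exec_Right: "exec Right x (right x) (1 + size x)"
  by (cases x) (simp_all del: val.size One_nat_def add: exec.intros)

lemma ptime_id: "ptime (\<lambda>x. x)"
  by (rule ptimeI[OF exec.Identity]) (intro poly_bounded_intros)

lemma ptime_Empty: "ptime (\<lambda>x. Empty)"
  by (rule ptimeI[OF exec.Const_Empty]) (intro poly_bounded_intros)

lemma ptime_comp:
  assumes "ptime f" "ptime g"
  shows "ptime (\<lambda>x. f (g x))"
proof -
  obtain P T where P: "\<And>x. exec P x (f x) (T x)" and T: "poly_bounded size T"
    using assms(1) by (rule ptimeE) blast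
  obtain Q S where Q: "\<And>x. exec Q x (g x) (S x)" and S: "poly_bounded size S"
    using assms(2) by (rule ptimeE) blast
  obtain p where p: "T x \<le> poly p (size x)" for x
    using T unfolding poly_bounded_def by blast
  have "poly_bounded size (\<lambda>x. T (g x))"
    by (rule poly_bounded_mono[OF poly_bounded_poly[OF ptime_size[OF assms(2)]]]) (rule p)
  then have "poly_bounded size (\<lambda>x. 1 + size x + S x + T (g x))"
    by (intro poly_bounded_intros S)
  with exec.Then[OF Q P] show ?thesis by (rule ptimeI)
qed

lemma ptime_left: "ptime f \<Longrightarrow> ptime (\<lambda>x. left (f x))"
  by (rule ptime_comp, rule ptimeI[OF exec_Left]) (intro poly_bounded_intros)

lemma ptime_right: "ptime f \<Longrightarrow> ptime (\<lambda>x. right (f x))"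
  by (rule ptime_comp, rule ptimeI[OF exec_Right]) (intro poly_bounded_intros)

lemma ptime_Join:
  assumes "ptime f" "ptime g"
  shows "ptime (\<lambda>x. Join (f x) (g x))"
proof -
  obtain P T where P: "\<And>x. exec P x (f x) (T x)" and T: "poly_bounded size T"
    using assms(1) by (rule ptimeE) blast
  obtain Q S where Q: "\<And>x. exec Q x (g x) (S x)" and S: "poly_bounded size S"
    using assms(2) by (rule ptimeE) blast
  have "poly_bounded size (\<lambda>x. 1 + size x + T x + S x)"
    by (intro poly_bounded_intros S T)
  with exec.Fork[OF P Q] show ?thesis by (rule ptimeI)
qed

lemma ptime_if_nonempty:
  assumes "ptime c" "ptime f" "ptime g"
  shows "ptime (\<lambda>x. if c x \<noteq> Empty then f x else g x)"
proof -
  obtain C U where C: "\<And>x. exec C x (c x) (U x)" and U: "poly_bounded size U"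
    using assms(1) by (rule ptimeE) blast
  obtain P T where P: "\<And>x. exec P x (f x) (T x)" and T: "poly_bounded size T"
    using assms(2) by (rule ptimeE) blast
  obtain Q S where Q: "\<And>x. exec Q x (g x) (S x)" and S: "poly_bounded size S"
    using assms(3) by (rule ptimeE) blast
  have "exec (Cond C P Q) x (if c x \<noteq> Empty then f x else g x)
          (1 + size x + U x + (if c x \<noteq> Empty then T x else S x))" for x
    using exec.Cond_true[OF C _ P] exec.Cond_false[OF _ Q] C[of x] by auto
  moreover have "poly_bounded size (\<lambda>x. 1 + size x + U x + (if c x \<noteq> Empty then T x else S x))"
    by (rule poly_bounded_mono[of _ "\<lambda>x. 1 + size x + U x + (T x + S x)"])
      (intro poly_bounded_intros U T S, simp)
  ultimately show ?thesis by (rule ptimeI)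
qed

primrec items :: "val \<Rightarrow> val list" where
  "items Empty = []"
| "items (Join x xs) = x # items xs"

text \<open>Every tree is the code of exactly one list. List functions can therefore be handled as
  functions on trees, without malformed inputs.\<close>

lemma code_list_items [simp]: "code_list (items v) = v"
  by (induction v) auto

lemma items_code_list [simp]: "items (code_list xs) = xs"
  by (induction xs) auto

lemma code_list_eq_Empty_iff [simp]: "code_list xs = Empty \<longleftrightarrow> xs = []"
  by (cases xs) auto

lemma right_code_list [simp]: "right (code_list xs) = code_list (tl xs)"
  by (cases xs) auto

lemma left_code_list: "xs \<noteq> [] \<Longrightarrow> left (code_list xs) = hd xs"
  by (cases xs) auto

section \<open>Sizes of lists and bounded loops\<close>

lemma size_code_list: "size (code_list xs) = length xs + (\<Sum>x\<leftarrow>xs. size x)"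
  by (induction xs) auto

lemma size_code_list_le:
  "(\<And>x. x \<in> set xs \<Longrightarrow> size x \<le> k) \<Longrightarrow> size (code_list xs) \<le> length xs * (k + 1)"
  by (induction xs) (auto, fastforce)

lemma length_le_size: "length xs \<le> size (code_list xs)"
  by (simp add: size_code_list)

lemma size_in_code_list: "x \<in> set xs \<Longrightarrow> size x \<le> size (code_list xs)"
  by (induction xs) auto

text \<open>A loop state consists of the remaining list, a fixed context \<open>x\<close> and the
  accumulator; \<open>Left\<close> exposes the list, whose emptiness stops the loop. Only states
  actually reached have to be bounded by \<open>M\<close>. A round costs at most 2 M + 2 for the
  loop and its test plus \<open>K\<close> for the body, and the final test is charged as one more
  round.\<close>

lemma exec_fold:
  assumes "\<And>y ys acc. exec B (Join (code_list (y # ys)) (Join x acc))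
             (Join (code_list ys) (Join x (g y acc))) (T (Join (code_list (y # ys)) (Join x acc)))"
    and "\<And>z. size z \<le> M \<Longrightarrow> T z \<le> K"
    and "\<And>ys zs. xs = ys @ zs \<Longrightarrow> size (Join (code_list zs) (Join x (fold g ys acc))) \<le> M"
  shows "\<exists>t \<le> (length xs + 1) * (2 * M + K + 2).
           exec (Loop Left B) (Join (code_list xs) (Join x acc)) (Join Empty (Join x (fold g xs acc))) t"
  using assms(3)
proof (induction xs arbitrary: acc)
  case Nil
  let ?z = "Join Empty (Join x acc)"
  have "exec Left ?z Empty (1 + size ?z)"
    using exec_Left[of ?z] by simp
  then have "exec (Loop Left B) ?z ?z (1 + size ?z + (1 + size ?z))"
    by (rule exec.Loop_stop)
  moreover have "size ?z \<le> M"
    using Nil.prems[of "[]" "[]"] by simp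
  ultimately show ?case
    by (intro exI[of _ "1 + size ?z + (1 + size ?z)"]) (auto simp del: val.size)
next
  case (Cons y ys)
  let ?z = "Join (code_list (y # ys)) (Join x acc)"
  have M: "size ?z \<le> M"
    using Cons.prems[of "[]" "y # ys"] by simp
  have "\<exists>t \<le> (length ys + 1) * (2 * M + K + 2). exec (Loop Left B)
      (Join (code_list ys) (Join x (g y acc))) (Join Empty (Join x (fold g ys (g y acc)))) t"
  proof (rule Cons.IH)
    fix us zs assume "ys = us @ zs"
    then show "size (Join (code_list zs) (Join x (fold g us (g y acc)))) \<le> M"
      using Cons.prems[of "y # us" zs] by simp
  qed
  then obtain t where t: "t \<le> (length ys + 1) * (2 * M + K + 2)"
    "exec (Loop Left B) (Join (code_list ys) (Join x (g y acc)))
       (Join Empty (Join x (fold g ys (g y acc)))) t" by blast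
  have "exec Left ?z (code_list (y # ys)) (1 + size ?z)"
    using exec_Left[of ?z] by simp
  from exec.Loop_step[OF this _ assms(1) t(2)]
  have "exec (Loop Left B) ?z (Join Empty (Join x (fold g (y # ys) acc)))
      (1 + size ?z + (1 + size ?z) + T ?z + t)" by simp
  moreover have "1 + size ?z + (1 + size ?z) + T ?z + t \<le> (length (y # ys) + 1) * (2 * M + K + 2)"
    using M t(1) assms(2)[OF M] by (simp add: algebra_simps del: val.size code_list.simps)
  ultimately show ?case by blast
qed

text \<open>A size bound on all intermediate accumulators is demanded, since a polynomial-time step
  that doubles the accumulator would reach exponential size. The step takes context, item and
  accumulator packed into one tree.\<close>

lemma ptime_fold:
  assumes l: "ptime (\<lambda>x. code_list (l x))" and a: "ptime a"
    and g: "ptime (\<lambda>z. g (left z) (left (right z)) (right (right z)))"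
    and bound: "poly_bounded size h"
      "\<And>x ys zs. l x = ys @ zs \<Longrightarrow> size (fold (g x) ys (a x)) \<le> h x"
  shows "ptime (\<lambda>x. fold (g x) (l x) (a x))"
proof -
  let ?b = "\<lambda>z. Join (right (left z)) (Join (left (right z))
              (g (left (right z)) (left (left z)) (right (right z))))"
  have "ptime (\<lambda>z. g (left (right z)) (left (left z)) (right (right z)))"
    using ptime_comp[OF g, of "\<lambda>z. Join (left (right z)) (Join (left (left z)) (right (right z)))"]
    by (simp add: ptime_Join ptime_left ptime_right ptime_id)
  then have "ptime ?b"
    by (intro ptime_Join ptime_left ptime_right ptime_id)
  then obtain B T where B: "\<And>z. exec B z (?b z) (T z)" and T: "poly_bounded size T"
    by (rule ptimeE) blast
  obtain q where q: "T z \<le> poly q (size z)" for z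
    using T unfolding poly_bounded_def by blast
  have "ptime (\<lambda>x. Join (code_list (l x)) (Join x (a x)))"
    by (intro ptime_Join ptime_id l a)
  then obtain I S where I: "\<And>x. exec I x (Join (code_list (l x)) (Join x (a x))) (S x)"
    and S: "poly_bounded size S"
    by (rule ptimeE) blast
  have "ptime (\<lambda>z. right (right z))" by (intro ptime_right ptime_id)
  then obtain E U where E: "\<And>x. exec E x (right (right x)) (U x)" and U: "poly_bounded size U"
    by (rule ptimeE) blast
  \<comment> \<open>The summand 2 counts the two \<open>Join\<close> nodes that hold a loop state
    together.\<close>
  define M where "M x = size (code_list (l x)) + size x + h x + 2" for x
  have M: "poly_bounded size M"
    unfolding M_def by (intro poly_bounded_intros bound(1) ptime_size[OF l])
  have le_M: "size (Join (code_list zs) (Join x (fold (g x) ys (a x)))) \<le> M x"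
    if "l x = ys @ zs" for x ys zs
    using bound(2)[OF that] that by (simp add: M_def size_code_list)
  have "\<exists>t \<le> (length (l x) + 1) * (2 * M x + poly q (M x) + 2).
      exec (Loop Left B) (Join (code_list (l x)) (Join x (a x)))
        (Join Empty (Join x (fold (g x) (l x) (a x)))) t" for x
  proof (rule exec_fold[where T = T])
    show "T z \<le> poly q (M x)" if "size z \<le> M x" for z
      using q[of z] poly_nat_mono[OF that] le_trans by blast
    show "exec B (Join (code_list (y # ys)) (Join x acc)) (Join (code_list ys) (Join x (g x y acc)))
        (T (Join (code_list (y # ys)) (Join x acc)))" for y ys acc
      using B[of "Join (code_list (y # ys)) (Join x acc)"] by simp
  qed (rule le_M)
  then obtain V where V: "V x \<le> (length (l x) + 1) * (2 * M x + poly q (M x) + 2)"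
    "exec (Loop Left B) (Join (code_list (l x)) (Join x (a x)))
       (Join Empty (Join x (fold (g x) (l x) (a x)))) (V x)" for x
    by metis
  let ?y = "\<lambda>x. Join (code_list (l x)) (Join x (a x))"
  let ?z = "\<lambda>x. Join Empty (Join x (fold (g x) (l x) (a x)))"
  have "exec (Then I (Then (Loop Left B) E)) x (fold (g x) (l x) (a x))
      (1 + size x + S x + (1 + size (?y x) + V x + U (?z x)))" for x
    using exec.Then[OF I[of x] exec.Then[OF V(2) E]] by simp
  moreover have "poly_bounded size (\<lambda>x. 1 + size x + S x + (1 + size (?y x) + V x + U (?z x)))"
  proof -
    obtain u where u: "U z \<le> poly u (size z)" for z
      using U unfolding poly_bounded_def by blast
    have "U (?z x) \<le> poly u (M x)" for x
      using u[of "?z x"] poly_nat_mono[OF le_M[of x "l x" "[]"], of u] by (simp del: val.size)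
    moreover have "size (?y x) \<le> M x" for x
      using le_M[of x "[]" "l x"] by (simp del: val.size)
    moreover have "V x \<le> (size (code_list (l x)) + 1) * (2 * M x + poly q (M x) + 2)" for x
      using V(1)[of x] mult_le_mono1[of "length (l x) + 1" "size (code_list (l x)) + 1"]
        length_le_size[of "l x"] le_trans by (metis add_le_mono1)
    ultimately have le: "1 + size x + S x + (1 + size (?y x) + V x + U (?z x)) \<le>
        1 + size x + S x + (1 + M x +
          (size (code_list (l x)) + 1) * (2 * M x + poly q (M x) + 2) + poly u (M x))" for x
      by (intro add_mono order_refl) auto
    show ?thesis
      by (rule poly_bounded_mono[OF _ le]) (intro poly_bounded_intros M S ptime_size[OF l])
  qed
  ultimately show ?thesis by (rule ptimeI)
qed

section \<open>List operations obtained from bounded loops\<close>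

lemma fold_Join: "fold Join xs v = code_list (rev xs @ items v)"
  by (induction xs arbitrary: v) auto

lemma size_code_list_rev [simp]: "size (code_list (rev xs)) = size (code_list xs)"
  by (simp add: size_code_list flip: rev_map)

lemma size_code_list_append [simp]:
  "size (code_list (xs @ ys)) = size (code_list xs) + size (code_list ys)"
  by (simp add: size_code_list)

text \<open>Moving items one at a time reverses them, so this is the primitive operation;
  \<open>ptime_append\<close> reverses its first list beforehand.\<close>

lemma ptime_revappend:
  assumes l: "ptime (\<lambda>x. code_list (l x))" and m: "ptime (\<lambda>x. code_list (m x))"
  shows "ptime (\<lambda>x. code_list (rev (l x) @ m x))"
proof -
  have "ptime (\<lambda>x. fold Join (l x) (code_list (m x)))"
  proof (rule ptime_fold[OF l m])
    show "poly_bounded size (\<lambda>x. size (code_list (l x)) + size (code_list (m x)))"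
      by (intro poly_bounded_intros ptime_size[OF l] ptime_size[OF m])
  qed (auto simp: fold_Join intro!: ptime_Join ptime_left ptime_right ptime_id)
  then show ?thesis by (simp add: fold_Join)
qed

lemma ptime_Nil: "ptime (\<lambda>x. code_list [])"
  by (simp add: ptime_Empty)

lemma ptime_rev: "ptime (\<lambda>x. code_list (l x)) \<Longrightarrow> ptime (\<lambda>x. code_list (rev (l x)))"
  using ptime_revappend[OF _ ptime_Nil, of l] by simp

lemma ptime_append:
  "ptime (\<lambda>x. code_list (l x)) \<Longrightarrow> ptime (\<lambda>x. code_list (m x)) \<Longrightarrow> ptime (\<lambda>x. code_list (l x @ m x))"
  using ptime_revappend[OF ptime_rev, of l m] by simp

lemma ptime_Cons:
  "ptime f \<Longrightarrow> ptime (\<lambda>x. code_list (l x)) \<Longrightarrow> ptime (\<lambda>x. code_list (f x # l x))"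
  by (simp add: ptime_Join)

lemma ptime_items: "ptime f \<Longrightarrow> ptime (\<lambda>x. code_list (items (f x)))"
  by simp

lemma fold_concat: "fold (\<lambda>y acc. code_list (f y @ items acc)) xs v =
  code_list (concat (map f (rev xs)) @ items v)"
  by (induction xs arbitrary: v) auto

lemma size_code_list_concat_map:
  "size (code_list (concat (map f xs))) = (\<Sum>x\<leftarrow>xs. size (code_list (f x)))"
  by (induction xs) auto

text \<open>Blocks are prepended to the accumulator, hence the fold over the reversed list. The
  result is bounded by the number of items times a common bound on blocks, which exists because each
  argument \<open>Join x y\<close> is no larger than \<open>x\<close> and the list together plus
  one.\<close>

lemma ptime_concat_map:
  assumes l: "ptime (\<lambda>x. code_list (l x))"
    and f: "ptime (\<lambda>z. code_list (f (left z) (right z)))"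
  shows "ptime (\<lambda>x. code_list (concat (map (f x) (l x))))"
proof -
  obtain p where p: "size (code_list (f (left z) (right z))) \<le> poly p (size z)" for z
    using ptime_size[OF f] unfolding poly_bounded_def by blast
  let ?B = "\<lambda>x. poly p (size x + size (code_list (l x)) + 1)"
  have le: "size (code_list (f x y)) \<le> ?B x" if "y \<in> set (l x)" for x y
  proof -
    have "size (code_list (f x y)) \<le> poly p (size (Join x y))"
      using p[of "Join x y"] by simp
    also have "\<dots> \<le> ?B x"
      using size_in_code_list[OF that] by (intro poly_nat_mono) simp
    finally show ?thesis .
  qed
  have "ptime (\<lambda>x. fold (\<lambda>y acc. code_list (f x y @ items acc)) (rev (l x)) Empty)"
  proof (rule ptime_fold[where h = "\<lambda>x. size (code_list (l x)) * ?B x"])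
    show "poly_bounded size (\<lambda>x. size (code_list (l x)) * ?B x)"
      by (intro poly_bounded_intros ptime_size[OF l])
    show "ptime (\<lambda>z. code_list (f (left z) (left (right z)) @ items (right (right z))))"
      using ptime_comp[OF f, of "\<lambda>z. Join (left z) (left (right z))"]
      by (intro ptime_append) (simp_all add: ptime_Join ptime_left ptime_right ptime_id)
    fix x ys zs assume l_x: "rev (l x) = ys @ zs"
    have "(\<Sum>y\<leftarrow>rev ys. size (code_list (f x y))) \<le> (\<Sum>y\<leftarrow>rev ys. ?B x)"
      using l_x by (intro sum_list_mono le) (metis Un_iff set_append set_rev)
    also have "\<dots> \<le> size (code_list (l x)) * ?B x"
      using arg_cong[OF l_x, of length] length_le_size[of "l x"]
      by (simp add: sum_list_triv)
    finally show "size (fold (\<lambda>y acc. code_list (f x y @ items acc)) ys Empty)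
        \<le> size (code_list (l x)) * ?B x"
      by (simp add: fold_concat size_code_list_concat_map)
  qed (intro ptime_rev l ptime_Empty)+
  then show ?thesis by (simp add: fold_concat)
qed

lemma ptime_map:
  assumes "ptime (\<lambda>x. code_list (l x))" "ptime (\<lambda>z. f (left z) (right z))"
  shows "ptime (\<lambda>x. code_list (map (f x) (l x)))"
proof -
  have "ptime (\<lambda>x. code_list (concat (map (\<lambda>y. [f x y]) (l x))))"
    using assms by (intro ptime_concat_map) (simp_all add: ptime_Join ptime_Empty)
  moreover have "concat (map (\<lambda>y. [f x y]) ys) = map (f x) ys" for x ys
    by (induction ys) auto
  ultimately show ?thesis by simp
qed

section \<open>Boolean tests\<close>

abbreviation code_bool :: "bool \<Rightarrow> val" where
  "code_bool b \<equiv> code_nat (of_bool b)"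

lemma code_bool_eq_Empty_iff [simp]: "code_bool b = Empty \<longleftrightarrow> \<not> b"
  by (cases b) auto

lemma ptime_if:
  assumes "ptime (\<lambda>x. code_bool (P x))" "ptime f" "ptime g"
  shows "ptime (\<lambda>x. if P x then f x else g x)"
  using ptime_if_nonempty[OF assms] by simp

lemma ptime_nonempty:
  assumes "ptime f"
  shows "ptime (\<lambda>x. code_bool (f x \<noteq> Empty))"
proof -
  have "ptime (\<lambda>x. if f x \<noteq> Empty then Join Empty Empty else Empty)"
    by (intro ptime_if_nonempty assms ptime_Join ptime_Empty)
  moreover have "(if f x \<noteq> Empty then Join Empty Empty else Empty) = code_bool (f x \<noteq> Empty)" for x
    by simp
  ultimately show ?thesis by simp
qed

lemma ptime_not: "ptime (\<lambda>x. code_bool (P x)) \<Longrightarrow> ptime (\<lambda>x. code_bool (\<not> P x))"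
proof -
  assume "ptime (\<lambda>x. code_bool (P x))"
  then have "ptime (\<lambda>x. if P x then Empty else Join Empty Empty)"
    by (intro ptime_if ptime_Join ptime_Empty)
  moreover have "(if P x then Empty else Join Empty Empty) = code_bool (\<not> P x)" for x
    by simp
  ultimately show ?thesis by simp
qed

lemma ptime_and:
  assumes "ptime (\<lambda>x. code_bool (P x))" "ptime (\<lambda>x. code_bool (Q x))"
  shows "ptime (\<lambda>x. code_bool (P x \<and> Q x))"
proof -
  have "ptime (\<lambda>x. if P x then code_bool (Q x) else Empty)"
    by (intro ptime_if ptime_Empty assms)
  moreover have "(if P x then code_bool (Q x) else Empty) = code_bool (P x \<and> Q x)" for x
    by simp
  ultimately show ?thesis by simp
qed

lemma ptime_or:
  assumes "ptime (\<lambda>x. code_bool (P x))" "ptime (\<lambda>x. code_bool (Q x))"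
  shows "ptime (\<lambda>x. code_bool (P x \<or> Q x))"
  using ptime_not[OF ptime_and[OF assms[THEN ptime_not]]] by simp

lemma ptime_filter:
  assumes "ptime (\<lambda>x. code_list (l x))" "ptime (\<lambda>z. code_bool (P (left z) (right z)))"
  shows "ptime (\<lambda>x. code_list (filter (P x) (l x)))"
proof -
  have "ptime (\<lambda>z. if P (left z) (right z) then code_list [right z] else code_list [])"
    by (intro ptime_if assms ptime_Cons ptime_right ptime_id ptime_Nil)
  then have "ptime (\<lambda>x. code_list (concat (map (\<lambda>y. if P x y then [y] else []) (l x))))"
    by (intro ptime_concat_map assms) (simp add: if_distrib[of code_list])
  moreover have "concat (map (\<lambda>y. if P x y then [y] else []) ys) = filter (P x) ys" for x ys
    by (induction ys) auto
  ultimately show ?thesis by simp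
qed

lemma ptime_bex:
  assumes "ptime (\<lambda>x. code_list (l x))" "ptime (\<lambda>z. code_bool (P (left z) (right z)))"
  shows "ptime (\<lambda>x. code_bool (\<exists>y \<in> set (l x). P x y))"
  using ptime_nonempty[OF ptime_filter[OF assms]] by (simp add: filter_empty_conv)

lemma code_nat_length: "code_nat (length xs) = code_list (map (\<lambda>_. Empty) xs)"
  by (induction xs) auto

lemma ptime_length: "ptime (\<lambda>x. code_list (l x)) \<Longrightarrow> ptime (\<lambda>x. code_nat (length (l x)))"
  unfolding code_nat_length by (intro ptime_map ptime_Empty)

lemma code_list_drop: "code_list (drop k xs) = (right ^^ k) (code_list xs)"
  by (induction k arbitrary: xs) (simp_all add: funpow_swap1 drop_Suc del: funpow.simps(2) add: funpow_Suc_right)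

text \<open>The threshold \<open>k\<close> is a constant and is compiled into the program: for
  positive \<open>k\<close>, something has to be left after \<open>k\<close> - 1 applications of
  \<open>right\<close>. No numbers are compared at run time.\<close>

lemma ptime_length_ge:
  assumes "ptime (\<lambda>x. code_list (l x))"
  shows "ptime (\<lambda>x. code_bool (k \<le> length (l x)))"
proof (cases k)
  case 0
  then show ?thesis by (simp add: ptime_Join ptime_Empty)
next
  case (Suc j)
  have "ptime (\<lambda>x. (right ^^ j) (code_list (l x)))"
    by (induction j) (simp_all add: assms ptime_right)
  then have "ptime (\<lambda>x. code_bool (code_list (drop j (l x)) \<noteq> Empty))"
    unfolding code_list_drop by (rule ptime_nonempty)
  then show ?thesis by (simp add: Suc not_le Suc_le_eq)
qed

text \<open>The unary numbers \<open>0, \<dots>, n - 1\<close> serve as names of the positions in a list of length \<open>n\<close>.\<close>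

definition positions :: "val list \<Rightarrow> val list" where
  "positions xs = map code_nat [0..<length xs]"

text \<open>One round turns the names 0, ..., k - 1 into 0, ..., k by incrementing all of them and
  putting 0 in front. The items of \<open>xs\<close> only count rounds.\<close>

lemma fold_positions: "fold (\<lambda>y acc. code_list (Empty # map (Join Empty) (items acc))) xs
    (code_list (map code_nat [0..<k])) = code_list (map code_nat [0..<k + length xs])"
proof (induction xs arbitrary: k)
  case (Cons x xs)
  have "Empty # map (Join Empty) (map code_nat [0..<k]) = map code_nat [0..<Suc k]"
    by (simp add: upt_conv_Cons flip: map_Suc_upt del: upt_Suc)
  with Cons[of "Suc k"] show ?case
    by (simp del: upt_Suc map_map code_list.simps)
qed simp

lemma size_code_nat [simp]: "size (code_nat k) = k"
  by (induction k) auto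

lemma size_code_nats: "size (code_list (map code_nat [0..<k])) \<le> k * (k + 1)"
  using size_code_list_le[of "map code_nat [0..<k]" k] by fastforce

lemma ptime_positions:
  assumes l: "ptime (\<lambda>x. code_list (l x))"
  shows "ptime (\<lambda>x. code_list (positions (l x)))"
proof -
  let ?n = "\<lambda>x. size (code_list (l x))"
  have "ptime (\<lambda>x. fold (\<lambda>y acc. code_list (Empty # map (Join Empty) (items acc))) (l x) Empty)"
  proof (rule ptime_fold[OF l])
    show "poly_bounded size (\<lambda>x. ?n x * (?n x + 1))"
      by (intro poly_bounded_intros ptime_size[OF l])
    show "ptime (\<lambda>z. code_list (Empty # map (Join Empty) (items (right (right z)))))"
      by (intro ptime_Cons ptime_Empty ptime_map ptime_items ptime_Join ptime_right ptime_id)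
    fix x ys zs assume "l x = ys @ zs"
    then have "length ys \<le> ?n x"
      using length_le_size[of "l x"] by simp
    then have "length ys * (length ys + 1) \<le> ?n x * (?n x + 1)"
      by (intro mult_mono) auto
    then show "size (fold (\<lambda>y acc. code_list (Empty # map (Join Empty) (items acc))) ys Empty)
        \<le> ?n x * (?n x + 1)"
      using fold_positions[of ys 0] size_code_nats[of "length ys"] by simp
  qed (rule ptime_Empty)
  moreover have "fold (\<lambda>y acc. code_list (Empty # map (Join Empty) (items acc))) xs Empty =
      code_list (positions xs)" for xs
    using fold_positions[of xs 0] by (simp add: positions_def)
  ultimately show ?thesis by simp
qed

section \<open>Reading entries and comparing positions\<close>

definition drop_at :: "val \<Rightarrow> val \<Rightarrow> val" where
  "drop_at i v = fold (\<lambda>_. right) (items i) v"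

definition entry :: "val \<Rightarrow> val \<Rightarrow> val" where
  "entry v i = left (drop_at i v)"

text \<open>On unary numbers \<open>drop_at\<close> is truncated subtraction, and numbers are equal
  when both differences vanish. The double negations match the shape of \<open>ptime_not\<close> and
  \<open>ptime_nonempty\<close>.\<close>

definition position_eq :: "val \<Rightarrow> val \<Rightarrow> bool" where
  "position_eq i j \<longleftrightarrow> \<not> drop_at i j \<noteq> Empty \<and> \<not> drop_at j i \<noteq> Empty"

lemma drop_at_code [simp]: "drop_at (code_nat k) (code_list xs) = code_list (drop k xs)"
proof -
  have "fold (\<lambda>_. right) (items (code_nat k)) v = (right ^^ k) v" for v
    by (induction k arbitrary: v) (simp_all add: funpow_swap1)
  then show ?thesis by (simp add: drop_at_def code_list_drop)
qed

lemma entry_code [simp]: "k < length xs \<Longrightarrow> entry (code_list xs) (code_nat k) = xs ! k"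
  by (simp add: entry_def left_code_list hd_drop_conv_nth)

lemma code_nat_eq_Empty_iff [simp]: "code_nat k = Empty \<longleftrightarrow> k = 0"
  by (cases k) auto

lemma position_eq_code [simp]: "position_eq (code_nat j) (code_nat k) \<longleftrightarrow> j = k"
proof -
  have "drop_at (code_nat j) (code_nat k) = code_nat (k - j)" for j k
    using drop_at_code[of j "replicate k Empty"] code_nat_length[of "replicate k Empty"]
      code_nat_length[of "replicate (k - j) Empty"] by simp
  then show ?thesis by (auto simp: position_eq_def)
qed

lemma size_fold_right: "size (fold (\<lambda>_. right) xs v) \<le> size v"
  by (induction xs arbitrary: v) (auto intro: le_trans size_right)

lemma ptime_drop_at:
  assumes "ptime i" "ptime v"
  shows "ptime (\<lambda>x. drop_at (i x) (v x))"
  unfolding drop_at_def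
  by (rule ptime_fold[OF ptime_items[OF assms(1)] assms(2) _ ptime_size[OF assms(2)]])
    (intro ptime_right ptime_id, rule size_fold_right)

lemma ptime_entry: "ptime v \<Longrightarrow> ptime i \<Longrightarrow> ptime (\<lambda>x. entry (v x) (i x))"
  unfolding entry_def by (intro ptime_left ptime_drop_at)

lemma ptime_position_eq:
  "ptime i \<Longrightarrow> ptime j \<Longrightarrow> ptime (\<lambda>x. code_bool (position_eq (i x) (j x)))"
  unfolding position_eq_def by (intro ptime_and ptime_not ptime_nonempty ptime_drop_at)

lemma ptime_is_Empty: "ptime f \<Longrightarrow> ptime (\<lambda>x. code_bool (f x = Empty))"
  using ptime_not[OF ptime_nonempty] by simp

lemmas ptime_intros =
  ptime_id ptime_Empty ptime_left ptime_right ptime_Join ptime_Nil ptime_Cons ptime_items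
  ptime_map ptime_concat_map ptime_filter ptime_positions ptime_length ptime_length_ge
  ptime_not ptime_and ptime_or ptime_bex ptime_is_Empty ptime_if ptime_entry ptime_position_eq

section \<open>A program for the algorithm\<close>

text \<open>
  The nodes \<open>N\<close> of a coded digraph are positions. Every modified digraph is written anew as a
  matrix, so sizes cannot accumulate in loops.
\<close>

definition linked :: "val \<Rightarrow> val \<Rightarrow> val \<Rightarrow> bool" where
  "linked M i j \<longleftrightarrow> entry (entry M i) j \<noteq> Empty"

definition build :: "val list \<Rightarrow> (val \<Rightarrow> val \<Rightarrow> bool) \<Rightarrow> val" where
  "build N Q = code_list (map (\<lambda>i. code_list (map (\<lambda>j. code_bool (Q i j)) N)) N)"

definition covered :: "val list \<Rightarrow> val \<Rightarrow> val \<Rightarrow> bool" where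
  "covered N F j \<longleftrightarrow> (\<exists>i \<in> set N. linked F i j)"

definition expanded :: "val list \<Rightarrow> val \<Rightarrow> val \<Rightarrow> bool" where
  "expanded N F i \<longleftrightarrow> (\<exists>j \<in> set N. linked F i j)"

definition heads :: "val list \<Rightarrow> val \<Rightarrow> val \<Rightarrow> val \<Rightarrow> val list" where
  "heads N D F i = filter (\<lambda>j. linked D i j \<and> \<not> covered N F j) N"

definition expand_node :: "val list \<Rightarrow> nat \<Rightarrow> val \<Rightarrow> val \<Rightarrow> val \<Rightarrow> val" where
  "expand_node N t D k F = build N (\<lambda>i j. linked F i j \<or>
     position_eq i k \<and> \<not> expanded N F k \<and> t \<le> length (heads N D F k) \<and>
     linked D k j \<and> \<not> covered N F j)"

definition expand :: "val list \<Rightarrow> nat \<Rightarrow> val \<Rightarrow> val \<Rightarrow> val" where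
  "expand N t D F = fold (expand_node N t D) N F"

text \<open>The candidate \<open>(v, None)\<close> becomes \<open>Join v Empty\<close>, and \<open>(v, Some u)\<close> becomes
  \<open>Join v (Join Empty u)\<close>: the second component is \<open>0\<close> or the successor of the position of \<open>u\<close>.\<close>

definition is_candidate :: "val list \<Rightarrow> val \<Rightarrow> val \<Rightarrow> val \<Rightarrow> bool" where
  "is_candidate N D F x \<longleftrightarrow> \<not> expanded N F (left x) \<and> \<not> 4 \<le> length (heads N D F (left x)) \<and>
     ((right x = Empty \<and> 2 \<le> length (heads N D F (left x))) \<or>
      (right x \<noteq> Empty \<and> 3 \<le> length (heads N D F (left x)) \<and>
       linked D (left x) (right (right x)) \<and> \<not> covered N F (right (right x))))"

definition list_candidates :: "val list \<Rightarrow> val \<Rightarrow> val \<Rightarrow> val list" where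
  "list_candidates N D F = filter (is_candidate N D F)
     (concat (map (\<lambda>i. Join i Empty # map (\<lambda>j. Join i (Join Empty j)) N) N))"

text \<open>\<open>Join Empty j\<close> is the successor of \<open>j\<close>. As a successor is
  never 0, one filter serves both kinds of candidates: it removes the designated head from the set
  of \<open>v\<^sub>u\<close> and nothing from that of \<open>v\<close>.\<close>

definition list_candidate_set :: "val list \<Rightarrow> val \<Rightarrow> val \<Rightarrow> val \<Rightarrow> val list" where
  "list_candidate_set N D F x =
     filter (\<lambda>j. \<not> position_eq (Join Empty j) (right x)) (heads N D F (left x))"

definition common_heads :: "val list \<Rightarrow> val \<Rightarrow> val \<Rightarrow> val \<Rightarrow> val \<Rightarrow> val list" where
  "common_heads N D F x y = filter (\<lambda>i. \<exists>j \<in> set (list_candidate_set N D F y). position_eq i j)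
     (list_candidate_set N D F x)"

text \<open>On unary numbers \<open>right\<close> is the predecessor, which gives the weights. The
  diagonal is treated separately because a set meets itself.\<close>

definition build_graph :: "val list \<Rightarrow> val \<Rightarrow> val \<Rightarrow> val" where
  "build_graph N D F = Join
     (code_list (map (\<lambda>x. right (code_nat (length (list_candidate_set N D F x))))
       (list_candidates N D F)))
     (code_list (map (\<lambda>x. code_list (map (\<lambda>y.
        if position_eq (left x) (left y) \<and> position_eq (right x) (right y) then Empty
        else code_nat (length (common_heads N D F x y))) (list_candidates N D F)))
       (list_candidates N D F)))"

text \<open>\<open>S\<close> is the answer of the subroutine, a 0/1 vector indexed by positions in
  the list of candidates; this is a different index set from the names of nodes.\<close>

definition add_selected :: "val list \<Rightarrow> val \<Rightarrow> val \<Rightarrow> val \<Rightarrow> val" where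
  "add_selected N D F S = build N (\<lambda>i j. linked F i j \<or>
     (\<exists>k \<in> set (positions (list_candidates N D F)). entry S k \<noteq> Empty \<and>
        position_eq i (left (entry (code_list (list_candidates N D F)) k)) \<and>
        (\<exists>j' \<in> set (list_candidate_set N D F (entry (code_list (list_candidates N D F)) k)).
           position_eq j j')))"

text \<open>Among the possible parents in \<open>D\<close> the one listed first is taken, which
  settles the choice that \<open>completes\<close> leaves open.\<close>

definition attach_uncovered :: "val list \<Rightarrow> val \<Rightarrow> val \<Rightarrow> val" where
  "attach_uncovered N D F = build N (\<lambda>i j. linked F i j \<or>
     \<not> covered N F j \<and> linked D i j \<and>
     position_eq i (left (code_list (filter (\<lambda>k. linked D k j) N))))"

definition first_phase :: "val \<Rightarrow> val" where
  "first_phase D = expand (positions (items D)) 4 D (build (positions (items D)) (\<lambda>_ _. False))"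

text \<open>The first phase is computed again, so that only the input has to be kept while the
  subroutine runs.\<close>

definition last_phase :: "val \<Rightarrow> val \<Rightarrow> val" where
  "last_phase D S = attach_uncovered (positions (items D)) D
     (expand (positions (items D)) 1 D (add_selected (positions (items D)) D (first_phase D) S))"


subsection \<open>Running time\<close>

lemma ptime_linked:
  "ptime M \<Longrightarrow> ptime i \<Longrightarrow> ptime j \<Longrightarrow> ptime (\<lambda>x. code_bool (linked (M x) (i x) (j x)))"
  unfolding linked_def by (intro ptime_intros)

lemma ptime_False: "ptime (\<lambda>x. code_bool False)"
  by (simp add: ptime_Empty)

text \<open>Variables bound inside the comprehension are passed by extending the argument to
  \<open>Join (Join x i) j\<close>.\<close>

lemma ptime_build:
  assumes N: "ptime (\<lambda>x. code_list (N x))"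
    and Q: "ptime (\<lambda>z. code_bool (Q (left (left z)) (right (left z)) (right z)))"
  shows "ptime (\<lambda>x. build (N x) (Q x))"
  unfolding build_def by (intro ptime_intros ptime_comp[OF N] N Q)

lemma ptime_covered:
  assumes N: "ptime (\<lambda>x. code_list (N x))" and F: "ptime F" and j: "ptime j"
  shows "ptime (\<lambda>x. code_bool (covered (N x) (F x) (j x)))"
  unfolding covered_def by (intro ptime_intros ptime_linked ptime_comp[OF F] ptime_comp[OF j] N)

lemma ptime_expanded:
  assumes N: "ptime (\<lambda>x. code_list (N x))" and F: "ptime F" and i: "ptime i"
  shows "ptime (\<lambda>x. code_bool (expanded (N x) (F x) (i x)))"
  unfolding expanded_def by (intro ptime_intros ptime_linked ptime_comp[OF F] ptime_comp[OF i] N)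

lemma ptime_heads:
  assumes N: "ptime (\<lambda>x. code_list (N x))" and D: "ptime D" and F: "ptime F" and i: "ptime i"
  shows "ptime (\<lambda>x. code_list (heads (N x) (D x) (F x) (i x)))"
  unfolding heads_def
  by (intro ptime_intros ptime_linked ptime_covered
      ptime_comp[OF N] ptime_comp[OF D] ptime_comp[OF F] ptime_comp[OF i] N)

lemma ptime_expand_node:
  assumes N: "ptime (\<lambda>x. code_list (N x))" and D: "ptime D" and k: "ptime k" and F: "ptime F"
  shows "ptime (\<lambda>x. expand_node (N x) t (D x) (k x) (F x))"
  unfolding expand_node_def
  by (intro ptime_build ptime_intros ptime_linked ptime_covered ptime_expanded ptime_heads
      ptime_comp[OF N] ptime_comp[OF D] ptime_comp[OF F] ptime_comp[OF k] N)

lemma size_build: "size (build N Q) \<le> length N * (length N * 2 + 1)"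
proof -
  have "size (code_list (map (\<lambda>j. code_bool (Q i j)) N)) \<le> length N * 2" for i
    by (rule order_trans[OF size_code_list_le[where k = 1]]) auto
  then show ?thesis
    unfolding build_def
    by (intro order_trans[OF size_code_list_le[where k = "length N * 2"]]) auto
qed

text \<open>After at least one step the accumulator is an output of \<open>build\<close>, whose size
  depends on the number of nodes only; before that it is \<open>F\<close>. This settles the size
  hypothesis of the fold without any invariant on \<open>F\<close>.\<close>

lemma ptime_expand:
  assumes N: "ptime (\<lambda>x. code_list (N x))" and D: "ptime D" and F: "ptime F"
  shows "ptime (\<lambda>x. expand (N x) t (D x) (F x))"
  unfolding expand_def
proof (rule ptime_fold[OF N F])
  let ?n = "\<lambda>x. size (code_list (N x))"
  show "poly_bounded size (\<lambda>x. size (F x) + ?n x * (?n x * 2 + 1))"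
    by (intro poly_bounded_intros ptime_size[OF N] ptime_size[OF F])
  show "ptime (\<lambda>z. expand_node (N (left z)) t (D (left z)) (left (right z)) (right (right z)))"
    by (intro ptime_expand_node ptime_intros ptime_comp[OF N] ptime_comp[OF D])
  show "size (fold (expand_node (N x) t (D x)) ys (F x)) \<le> size (F x) + ?n x * (?n x * 2 + 1)"
    for x ys
  proof (cases ys rule: rev_cases)
    case (snoc us k)
    have "size (fold (expand_node (N x) t (D x)) ys (F x)) \<le> length (N x) * (length (N x) * 2 + 1)"
      unfolding snoc by (simp add: expand_node_def size_build[simplified])
    also have "\<dots> \<le> ?n x * (?n x * 2 + 1)"
      using length_le_size[of "N x"] by (intro mult_mono add_mono) auto
    finally show ?thesis by simp
  qed simp
qed

lemma ptime_is_candidate: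
  assumes N: "ptime (\<lambda>x. code_list (N x))" and D: "ptime D" and F: "ptime F" and i: "ptime i"
  shows "ptime (\<lambda>x. code_bool (is_candidate (N x) (D x) (F x) (i x)))"
  unfolding is_candidate_def
  by (intro ptime_intros ptime_linked ptime_covered ptime_expanded ptime_heads assms)

lemma ptime_list_candidates:
  assumes N: "ptime (\<lambda>x. code_list (N x))" and D: "ptime D" and F: "ptime F"
  shows "ptime (\<lambda>x. code_list (list_candidates (N x) (D x) (F x)))"
  unfolding list_candidates_def
  by (intro ptime_intros ptime_is_candidate
      ptime_comp[OF N] ptime_comp[OF D] ptime_comp[OF F] N)

lemma ptime_list_candidate_set:
  assumes N: "ptime (\<lambda>x. code_list (N x))" and D: "ptime D" and F: "ptime F" and i: "ptime i"
  shows "ptime (\<lambda>x. code_list (list_candidate_set (N x) (D x) (F x) (i x)))"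
  unfolding list_candidate_set_def
  by (intro ptime_intros ptime_heads ptime_comp[OF i] assms)

lemma ptime_common_heads:
  assumes N: "ptime (\<lambda>x. code_list (N x))" and D: "ptime D" and F: "ptime F"
    and i: "ptime i" and j: "ptime j"
  shows "ptime (\<lambda>x. code_list (common_heads (N x) (D x) (F x) (i x) (j x)))"
  unfolding common_heads_def
  by (intro ptime_intros ptime_list_candidate_set
      ptime_comp[OF N] ptime_comp[OF D] ptime_comp[OF F] ptime_comp[OF j] assms)

lemma ptime_build_graph:
  assumes N: "ptime (\<lambda>x. code_list (N x))" and D: "ptime D" and F: "ptime F"
  shows "ptime (\<lambda>x. build_graph (N x) (D x) (F x))"
  unfolding build_graph_def
  by (intro ptime_intros ptime_list_candidates ptime_list_candidate_set ptime_common_heads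
      ptime_comp[OF N] ptime_comp[OF D] ptime_comp[OF F] assms)

lemma ptime_add_selected:
  assumes N: "ptime (\<lambda>x. code_list (N x))" and D: "ptime D" and F: "ptime F" and S: "ptime S"
  shows "ptime (\<lambda>x. add_selected (N x) (D x) (F x) (S x))"
  unfolding add_selected_def
  by (intro ptime_build ptime_intros ptime_linked ptime_list_candidates ptime_list_candidate_set
      ptime_comp[OF N] ptime_comp[OF D] ptime_comp[OF F] ptime_comp[OF S] assms)

lemma ptime_attach_uncovered:
  assumes N: "ptime (\<lambda>x. code_list (N x))" and D: "ptime D" and F: "ptime F"
  shows "ptime (\<lambda>x. attach_uncovered (N x) (D x) (F x))"
  unfolding attach_uncovered_def
  by (intro ptime_build ptime_intros ptime_linked ptime_covered
      ptime_comp[OF N] ptime_comp[OF D] ptime_comp[OF F] assms)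

lemma ptime_first_phase: "ptime D \<Longrightarrow> ptime (\<lambda>x. first_phase (D x))"
  unfolding first_phase_def by (intro ptime_expand ptime_build ptime_intros ptime_False)

lemma ptime_last_phase: "ptime D \<Longrightarrow> ptime S \<Longrightarrow> ptime (\<lambda>x. last_phase (D x) (S x))"
  unfolding last_phase_def
  by (intro ptime_attach_uncovered ptime_expand ptime_add_selected ptime_first_phase ptime_intros)

subsection \<open>Correctness\<close>

definition position :: "'v list \<Rightarrow> 'v \<Rightarrow> nat" where
  "position xs v = length (takeWhile (\<lambda>w. w \<noteq> v) xs)"

lemma position_less: "v \<in> set xs \<Longrightarrow> position xs v < length xs"
  unfolding position_def by (induction xs) auto

lemma nth_position: "v \<in> set xs \<Longrightarrow> xs ! position xs v = v"
  unfolding position_def by (induction xs) auto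

lemma position_nth: "distinct xs \<Longrightarrow> k < length xs \<Longrightarrow> position xs (xs ! k) = k"
  by (metis nth_eq_iff_index_eq nth_mem nth_position position_less)

lemma position_inj: "u \<in> set xs \<Longrightarrow> v \<in> set xs \<Longrightarrow> position xs u = position xs v \<longleftrightarrow> u = v"
  by (metis nth_position)

abbreviation name :: "'v list \<Rightarrow> 'v \<Rightarrow> val" where
  "name xs v \<equiv> code_nat (position xs v)"

lemma positions_map: "distinct xs \<Longrightarrow> positions (map f xs) = map (name xs) xs"
  unfolding positions_def by (rule nth_equalityI) (auto simp: position_nth)

lemma entry_map: "v \<in> set xs \<Longrightarrow> entry (code_list (map f xs)) (name xs v) = f v"
  by (simp add: position_less nth_position)

lemma position_eq_name:
  "u \<in> set xs \<Longrightarrow> v \<in> set xs \<Longrightarrow> position_eq (name xs u) (name xs v) \<longleftrightarrow> u = v"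
  by (simp add: position_inj)

lemma code_vector_inj:
  "code_vector xs f = code_vector xs g \<Longrightarrow> x \<in> set xs \<Longrightarrow> f x = g x"
  unfolding code_vector_def by (metis entry_map size_code_nat)

text \<open>Degrees are cardinalities, and an infinite set of entering arcs would also be given
  degree 0.\<close>

lemma in_degree_eq_0_iff:
  fixes F :: "'v pair_pre_digraph"
  assumes "finite (parcs F)"
  shows "in_degree F u = 0 \<longleftrightarrow> (\<forall>v. (v, u) \<notin> parcs F)"
proof -
  have "finite (in_arcs F u)"
    using assms by (simp add: in_arcs_def)
  then show ?thesis by (auto simp: in_degree_def in_arcs_def)
qed

lemma out_degree_eq_0_iff:
  fixes F :: "'v pair_pre_digraph"
  assumes "finite (parcs F)"
  shows "out_degree F u = 0 \<longleftrightarrow> (\<forall>v. (u, v) \<notin> parcs F)"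
proof -
  have "finite (out_arcs F u)"
    using assms by (simp add: out_arcs_def)
  then show ?thesis by (auto simp: out_degree_def out_arcs_def)
qed

lemma free_heads_iff: "u \<in> free_heads D F v \<longleftrightarrow> (v, u) \<in> parcs D \<and> in_degree F u = 0"
  by (simp add: free_heads_def)

lemma card_pairs: "card {(v, u) | u. u \<in> S} = card S"
proof -
  have "{(v, u) | u. u \<in> S} = Pair v ` S" by auto
  then show ?thesis by (simp add: card_image inj_on_def)
qed

lemma greedy_step_eq: "greedy_step D t v F =
  (if out_degree F v = 0 \<and> t \<le> card (free_heads D F v)
   then F\<lparr>parcs := parcs F \<union> {(v, u) | u. u \<in> free_heads D F v}\<rparr> else F)"
  by (simp only: greedy_step_def Let_def card_pairs)

lemma fst_candidate: "x \<in> candidates D F \<Longrightarrow> fst x \<in> pverts D"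
  unfolding candidates_def by (elim UnE CollectE exE conjE) simp_all

locale enumerated_digraph =
  fixes vs :: "'v list" and D :: "'v pair_pre_digraph"
  assumes distinct_vs: "distinct vs"
    and arcs_D: "parcs D \<subseteq> set vs \<times> set vs"
begin

definition inside :: "'v pair_pre_digraph \<Rightarrow> bool" where
  "inside F \<longleftrightarrow> parcs F \<subseteq> set vs \<times> set vs"

lemma finite_inside: "inside F \<Longrightarrow> finite (parcs F)"
  unfolding inside_def by (rule finite_subset) auto

abbreviation (input) N :: "val list" where
  "N \<equiv> map (name vs) vs"

abbreviation (input) code :: "'v pair_pre_digraph \<Rightarrow> val" where
  "code F \<equiv> code_digraph vs F"

lemma positions_code: "positions (items (code F)) = N"
  unfolding code_digraph_def code_matrix_def using positions_map[OF distinct_vs] by simp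

lemma linked_code:
  "u \<in> set vs \<Longrightarrow> v \<in> set vs \<Longrightarrow> linked (code F) (name vs u) (name vs v) \<longleftrightarrow> (u, v) \<in> parcs F"
  by (simp add: linked_def code_digraph_def code_matrix_def code_vector_def entry_map del: entry_code)

text \<open>Only arcs are encoded, so the correctness of a rewritten matrix reduces to a pointwise
  description of the arcs of the result.\<close>

lemma build_code:
  "(\<And>u v. u \<in> set vs \<Longrightarrow> v \<in> set vs \<Longrightarrow> Q (name vs u) (name vs v) \<longleftrightarrow> (u, v) \<in> parcs F) \<Longrightarrow>
     build N Q = code F"
  by (simp add: build_def code_digraph_def code_matrix_def code_vector_def cong: map_cong)

lemma covered_code:
  "inside F \<Longrightarrow> v \<in> set vs \<Longrightarrow> covered N (code F) (name vs v) \<longleftrightarrow> in_degree F v \<noteq> 0"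
  by (auto simp: covered_def linked_code in_degree_eq_0_iff finite_inside inside_def)

lemma expanded_code:
  "inside F \<Longrightarrow> v \<in> set vs \<Longrightarrow> expanded N (code F) (name vs v) \<longleftrightarrow> out_degree F v \<noteq> 0"
  by (auto simp: expanded_def linked_code out_degree_eq_0_iff finite_inside inside_def)

lemma heads_code:
  assumes "inside F" "v \<in> set vs"
  shows "heads N (code D) (code F) (name vs v) =
    map (name vs) (filter (\<lambda>u. u \<in> free_heads D F v) vs)"
  using assms
  by (simp add: heads_def filter_map linked_code covered_code free_heads_def cong: filter_cong)

lemma free_heads_subset: "free_heads D F v \<subseteq> set vs"
  using arcs_D by (auto simp: free_heads_def)

lemma length_filter_card:
  assumes "S \<subseteq> set vs"
  shows "length (filter (\<lambda>u. u \<in> S) vs) = card S"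
proof -
  have "set (filter (\<lambda>u. u \<in> S) vs) = S" using assms by auto
  then show ?thesis
    using distinct_card[of "filter (\<lambda>u. u \<in> S) vs"] distinct_vs by simp
qed

lemma length_heads_code:
  "inside F \<Longrightarrow> v \<in> set vs \<Longrightarrow>
    length (heads N (code D) (code F) (name vs v)) = card (free_heads D F v)"
  by (simp add: heads_code length_filter_card free_heads_subset)

lemma inside_greedy_step: "inside F \<Longrightarrow> inside (greedy_step D t v F)"
  using arcs_D by (auto simp: inside_def greedy_step_def Let_def free_heads_def)

lemma expand_node_code:
  assumes "inside F" "v \<in> set vs"
  shows "expand_node N t (code D) (name vs v) (code F) = code (greedy_step D t v F)"
  unfolding expand_node_def
  using assms
  by (intro build_code)
    (auto simp: linked_code position_eq_name expanded_code length_heads_code covered_code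
      greedy_step_eq free_heads_iff simp del: position_eq_code)

lemma greedy_expand_code:
  "inside F \<Longrightarrow> expand N t (code D) (code F) = code (greedy_expand D t vs F)"
  "inside F \<Longrightarrow> inside (greedy_expand D t vs F)"
proof -
  have "fold (expand_node N t (code D)) (map (name vs) us) (code F) =
      code (fold (greedy_step D t) us F) \<and> inside (fold (greedy_step D t) us F)"
    if "inside F" "set us \<subseteq> set vs" for us
    using that
    by (induction us arbitrary: F) (simp_all add: expand_node_code inside_greedy_step)
  then show "inside F \<Longrightarrow> expand N t (code D) (code F) = code (greedy_expand D t vs F)"
    "inside F \<Longrightarrow> inside (greedy_expand D t vs F)"
    unfolding expand_def greedy_expand_def by simp_all
qed

lemma first_phase_code:
  "first_phase (code D) = code (greedy_expand D 4 vs \<lparr>pverts = pverts D, parcs = {}\<rparr>)"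
proof -
  have "build N (\<lambda>_ _. False) = code \<lparr>pverts = pverts D, parcs = {}\<rparr>"
    by (rule build_code) simp
  then show ?thesis
    unfolding first_phase_def positions_code
    by (subst greedy_expand_code(1)[symmetric]) (simp_all add: inside_def)
qed

section \<open>Candidates and their intersection graph in coded form\<close>

definition candidate_list :: "'v pair_pre_digraph \<Rightarrow> 'v candidate list" where
  "candidate_list F = filter (\<lambda>x. x \<in> candidates D F)
     (concat (map (\<lambda>v. (v, None) # map (\<lambda>u. (v, Some u)) vs) vs))"

fun candidate_name :: "'v candidate \<Rightarrow> val" where
  "candidate_name (v, None) = Join (name vs v) Empty"
| "candidate_name (v, Some u) = Join (name vs v) (Join Empty (name vs u))"

lemma distinct_all_candidates:
  "distinct us \<Longrightarrow> distinct (concat (map (\<lambda>v. (v, None) # map (\<lambda>u. (v, Some u)) vs) us))"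
  by (induction us) (auto simp: distinct_map distinct_vs inj_on_def)

lemma enumerates_candidate_list:
  assumes "pverts D = set vs"
  shows "enumerates (candidate_list F) (candidates D F)"
proof -
  have "set (concat (map (\<lambda>v. (v, None) # map (\<lambda>u. (v, Some u)) vs) vs)) =
      set vs \<times> ({None} \<union> Some ` set vs)" by auto
  moreover have "candidates D F \<subseteq> set vs \<times> ({None} \<union> Some ` set vs)"
    using free_heads_subset[of F] assms by (auto simp: candidates_def)
  ultimately show ?thesis
    unfolding enumerates_def candidate_list_def
    using distinct_all_candidates[OF distinct_vs] by auto
qed

lemma list_candidates_code:
  assumes "inside F" "pverts D = set vs"
  shows "list_candidates N (code D) (code F) = map candidate_name (candidate_list F)"
proof -
  let ?all = "\<lambda>us. concat (map (\<lambda>v. (v, None) # map (\<lambda>u. (v, Some u)) vs) us)"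
  have all: "concat (map (\<lambda>i. Join i Empty # map (\<lambda>j. Join i (Join Empty j)) N) (map (name vs) us)) =
      map candidate_name (?all us)" for us
    by (induction us) auto
  have "is_candidate N (code D) (code F) (candidate_name x) \<longleftrightarrow> x \<in> candidates D F"
    if "x \<in> set (?all vs)" for x
    using that assms
    by (auto simp: is_candidate_def expanded_code length_heads_code linked_code covered_code
        candidates_def free_heads_def)
  then show ?thesis
    unfolding list_candidates_def candidate_list_def all filter_map o_def
    by (intro arg_cong[where f = "map candidate_name"] filter_cong refl)
qed

lemma candidate_set_subset: "candidate_set D F x \<subseteq> set vs"
  using free_heads_subset[of F] by (cases "(D, F, x)" rule: candidate_set.cases) auto

lemma list_candidate_set_code:
  assumes "inside F" "pverts D = set vs" "x \<in> candidates D F"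
  shows "list_candidate_set N (code D) (code F) (candidate_name x) =
    map (name vs) (filter (\<lambda>u. u \<in> candidate_set D F x) vs)"
proof -
  have *: "u \<in> set vs" if "u \<in> free_heads D F v" for u v
    using that free_heads_subset by blast
  \<comment> \<open>\<open>Join Empty\<close> is the successor on unary codes, and simplification
    unfolds codes of successors to it. Both facts compare numbers in this unfolded form.\<close>
  have "position_eq (Join Empty (code_nat k)) Empty \<longleftrightarrow> False" for k
    using position_eq_code[of "Suc k" 0] by simp
  moreover have "position_eq (Join Empty (code_nat j)) (Join Empty (code_nat k)) \<longleftrightarrow> j = k" for j k
    using position_eq_code[of "Suc j" "Suc k"] by simp
  ultimately show ?thesis
    using assms
    by (auto simp: candidates_def list_candidate_set_def heads_code filter_map position_inj *
        cong: filter_cong)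
qed

lemma common_heads_code:
  assumes "inside F" "pverts D = set vs" "x \<in> candidates D F" "y \<in> candidates D F"
  shows "length (common_heads N (code D) (code F) (candidate_name x) (candidate_name y)) =
    card (candidate_set D F x \<inter> candidate_set D F y)"
proof -
  have "common_heads N (code D) (code F) (candidate_name x) (candidate_name y) =
      map (name vs) (filter (\<lambda>u. u \<in> candidate_set D F x \<inter> candidate_set D F y) vs)"
    using assms
    by (simp add: common_heads_def list_candidate_set_code filter_map position_inj
        cong: filter_cong conj_cong)
  then show ?thesis
    using candidate_set_subset by (simp only: length_map) (rule length_filter_card, blast)
qed

lemma code_nat_pred: "right (code_nat k) = code_nat (k - 1)"
  by (cases k) auto

lemma position_eq_candidate_name:
  assumes "pverts D = set vs" "x \<in> candidates D F" "y \<in> candidates D F"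
  shows "position_eq (left (candidate_name x)) (left (candidate_name y)) \<and>
    position_eq (right (candidate_name x)) (right (candidate_name y)) \<longleftrightarrow> x = y"
proof -
  have *: "u \<in> set vs" if "u \<in> free_heads D F v" for u v
    using that free_heads_subset by blast
  have "position_eq (Join Empty (code_nat k)) Empty \<longleftrightarrow> False"
    "position_eq Empty (Join Empty (code_nat k)) \<longleftrightarrow> False"
    "position_eq Empty Empty \<longleftrightarrow> True" for k
    using position_eq_code[of "Suc k" 0] position_eq_code[of 0 "Suc k"] position_eq_code[of 0 0]
    by simp_all
  moreover have "position_eq (Join Empty (code_nat j)) (Join Empty (code_nat k)) \<longleftrightarrow> j = k" for j k
    using position_eq_code[of "Suc j" "Suc k"] by simp
  ultimately show ?thesis
    using assms by (auto simp: candidates_def position_inj *)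
qed

lemma build_graph_code:
  assumes "inside F" "pverts D = set vs"
  shows "build_graph N (code D) (code F) = code_weighted_multigraph (candidate_list F)
    (intersection_graph (candidates D F) (candidate_set D F))"
proof -
  have c: "x \<in> candidates D F" if "x \<in> set (candidate_list F)" for x
    using that by (simp add: candidate_list_def)
  have weight: "right (code_nat (length (list_candidate_set N (code D) (code F) (candidate_name x)))) =
      code_nat (card (candidate_set D F x) - 1)" if "x \<in> set (candidate_list F)" for x
    using that by (simp only: list_candidate_set_code[OF assms c] length_map
        length_filter_card[OF candidate_set_subset] code_nat_pred)
  have multiplicity: "(if position_eq (left (candidate_name x)) (left (candidate_name y)) \<and>
          position_eq (right (candidate_name x)) (right (candidate_name y)) then Empty
        else code_nat (length (common_heads N (code D) (code F) (candidate_name x) (candidate_name y)))) =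
      code_nat (if x = y then 0 else card (candidate_set D F x \<inter> candidate_set D F y))"
    if "x \<in> set (candidate_list F)" "y \<in> set (candidate_list F)" for x y
    using that by (simp only: position_eq_candidate_name[OF assms(2) c c]
        common_heads_code[OF assms c c]) simp
  show ?thesis
    unfolding build_graph_def code_weighted_multigraph_def code_matrix_def code_vector_def
      list_candidates_code[OF assms] intersection_graph_def map_map o_def weighted_multigraph.simps
    by (intro arg_cong2[where f = Join] arg_cong[where f = code_list] map_cong refl
        weight multiplicity)
qed

lemma left_candidate_name: "left (candidate_name x) = name vs (fst x)"
  by (cases x rule: candidate_name.cases) auto

lemma add_selected_code:
  assumes "inside F" "pverts D = set vs" "I \<subseteq> candidates D F"
  shows "add_selected N (code D) (code F) (code_subset (candidate_list F) I) =
    code (F\<lparr>parcs := parcs F \<union> {(fst x, u) | x u. x \<in> I \<and> u \<in> candidate_set D F x}\<rparr>)"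
  unfolding add_selected_def list_candidates_code[OF assms(1,2)]
proof (rule build_code)
  let ?xs = "candidate_list F"
  have xs: "distinct ?xs" "set ?xs = candidates D F"
    using enumerates_candidate_list[OF assms(2), of F] by (simp_all add: enumerates_def)
  have fst_in: "fst x \<in> set vs" if "x \<in> candidates D F" for x
    using fst_candidate[OF that] assms(2) by simp
  \<comment> \<open>The names of candidates run through exactly the positions of the list, so a
    search over positions is a search over candidates.\<close>
  have positions_bex: "(\<exists>k \<in> set (positions (map candidate_name ?xs)). P k) \<longleftrightarrow>
      (\<exists>x \<in> candidates D F. P (name ?xs x))" for P
    unfolding positions_map[OF xs(1)] set_map xs(2) by (rule bex_simps(7))
  fix u v assume uv: "u \<in> set vs" "v \<in> set vs"
  have selected: "(\<exists>k \<in> set (positions (map candidate_name ?xs)). entry (code_subset ?xs I) k \<noteq> Empty \<and>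
        position_eq (name vs u) (left (entry (code_list (map candidate_name ?xs)) k)) \<and>
        (\<exists>j' \<in> set (list_candidate_set N (code D) (code F)
            (entry (code_list (map candidate_name ?xs)) k)). position_eq (name vs v) j')) \<longleftrightarrow>
      (\<exists>x \<in> candidates D F. x \<in> I \<and> u = fst x \<and> v \<in> candidate_set D F x)"
    unfolding positions_bex
  proof (rule bex_cong[OF refl])
    fix x assume x: "x \<in> candidates D F"
    then have x': "x \<in> set ?xs" by (simp add: xs(2))
    have "list_candidate_set N (code D) (code F) (candidate_name x) =
        map (name vs) (filter (\<lambda>u. u \<in> candidate_set D F x) vs)"
      by (rule list_candidate_set_code[OF assms(1,2) x])
    then have "(\<exists>j' \<in> set (list_candidate_set N (code D) (code F) (candidate_name x)).
        position_eq (name vs v) j') \<longleftrightarrow> v \<in> candidate_set D F x"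
      using uv by (auto simp: position_inj)
    moreover have "entry (code_subset ?xs I) (name ?xs x) \<noteq> Empty \<longleftrightarrow> x \<in> I"
      unfolding code_subset_def code_vector_def entry_map[OF x'] by simp
    moreover have "position_eq (name vs u) (left (candidate_name x)) \<longleftrightarrow> u = fst x"
      unfolding left_candidate_name by (rule position_eq_name[OF uv(1) fst_in[OF x]])
    ultimately show "entry (code_subset ?xs I) (name ?xs x) \<noteq> Empty \<and>
        position_eq (name vs u) (left (entry (code_list (map candidate_name ?xs)) (name ?xs x))) \<and>
        (\<exists>j' \<in> set (list_candidate_set N (code D) (code F)
            (entry (code_list (map candidate_name ?xs)) (name ?xs x))). position_eq (name vs v) j') \<longleftrightarrow>
        x \<in> I \<and> u = fst x \<and> v \<in> candidate_set D F x"
      unfolding entry_map[OF x'] by (simp only:)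
  qed
  show "linked (code F) (name vs u) (name vs v) \<or>
      (\<exists>k \<in> set (positions (map candidate_name ?xs)). entry (code_subset ?xs I) k \<noteq> Empty \<and>
        position_eq (name vs u) (left (entry (code_list (map candidate_name ?xs)) k)) \<and>
        (\<exists>j' \<in> set (list_candidate_set N (code D) (code F)
            (entry (code_list (map candidate_name ?xs)) k)). position_eq (name vs v) j')) \<longleftrightarrow>
      (u, v) \<in> parcs (F\<lparr>parcs := parcs F \<union>
        {(fst x, u) | x u. x \<in> I \<and> u \<in> candidate_set D F x}\<rparr>)"
    unfolding selected linked_code[OF uv] using assms(3) by auto
qed

lemma attach_uncovered_code:
  assumes "inside T"
  shows "\<exists>T'. completes D T T' \<and> attach_uncovered N (code D) (code T) = code T'"
proof -
  let ?p = "\<lambda>v. filter (\<lambda>u. (u, v) \<in> parcs D) vs"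
  let ?W = "{v. in_degree T v = 0 \<and> in_degree D v > 0}"
  have inside_D: "inside D" using arcs_D by (simp add: inside_def)
  have p: "(hd (?p v), v) \<in> parcs D" "hd (?p v) \<in> set vs" if "(u, v) \<in> parcs D" for u v
  proof -
    have "u \<in> set (?p v)" using that arcs_D by auto
    then have "hd (?p v) \<in> set (?p v)" by (metis empty_iff empty_set hd_in_set)
    then show "(hd (?p v), v) \<in> parcs D" "hd (?p v) \<in> set vs" by auto
  qed
  \<comment> \<open>The parent of \<open>v\<close> is its first in-neighbour in \<open>vs\<close>.
    Only nodes of positive in-degree in \<open>D\<close> are attached, so \<open>hd\<close> is not
    applied to an empty list.\<close>
  define T' where "T' = T\<lparr>parcs := parcs T \<union> {(hd (?p v), v) | v. v \<in> ?W}\<rparr>"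
  have W: "v \<in> ?W \<longleftrightarrow> in_degree T v = 0 \<and> (\<exists>u. (u, v) \<in> parcs D)" for v
    using in_degree_eq_0_iff[OF finite_inside[OF inside_D], of v] by auto
  have "completes D T T'"
    unfolding completes_def Let_def T'_def using p W by (intro exI[of _ "\<lambda>v. hd (?p v)"]) auto
  moreover have "attach_uncovered N (code D) (code T) = code T'"
    unfolding attach_uncovered_def
  proof (rule build_code)
    fix u v assume uv: "u \<in> set vs" "v \<in> set vs"
    have *: "filter (\<lambda>k. linked (code D) k (name vs v)) N = map (name vs) (?p v)"
      using uv by (simp add: filter_map linked_code cong: filter_cong)
    have "position_eq (name vs u)
        (left (code_list (filter (\<lambda>k. linked (code D) k (name vs v)) N))) \<longleftrightarrow> u = hd (?p v)"
      if "(u, v) \<in> parcs D"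
    proof -
      have "?p v \<noteq> []" using that uv by (auto simp: filter_empty_conv)
      then show ?thesis
        using p(2)[OF that] uv unfolding * by (simp add: left_code_list hd_map position_inj)
    qed
    then show "linked (code T) (name vs u) (name vs v) \<or>
        \<not> covered N (code T) (name vs v) \<and> linked (code D) (name vs u) (name vs v) \<and>
        position_eq (name vs u)
          (left (code_list (filter (\<lambda>k. linked (code D) k (name vs v)) N))) \<longleftrightarrow>
        (u, v) \<in> parcs T'"
      using uv assms W[of v] p by (auto simp: linked_code covered_code T'_def)
  qed
  ultimately show ?thesis by blast
qed

end

section \<open>The independent set subroutine\<close>

text \<open>The guarantees for the subroutine concern graphs on natural numbers. They carry over to
  the graph of candidates since a program sees only positions.\<close>

lemma hereditary_image:
  assumes V: "hereditary_23_collection V U" and g: "bij_betw g W V"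
    and f: "inj_on f (\<Union> (U ` V))"
  shows "hereditary_23_collection W (\<lambda>w. f ` U (g w))"
proof -
  have gW: "g w \<in> V" if "w \<in> W" for w
    using that g by (auto simp: bij_betw_def)
  have Vg: "\<exists>w \<in> W. g w = v" if "v \<in> V" for v
    using that g by (auto simp: bij_betw_def)
  have f': "inj_on f (U v)" if "v \<in> V" for v
    using f by (rule inj_on_subset) (use that in blast)
  have card: "card (f ` U v) = card (U v)" if "v \<in> V" for v
    using card_image[OF f'[OF that]] .
  have "\<exists>w\<^sub>a \<in> W. \<exists>w\<^sub>b \<in> W. \<exists>w\<^sub>c \<in> W.
      f ` U (g w\<^sub>a) = {b, c} \<and> f ` U (g w\<^sub>b) = {a, c} \<and> f ` U (g w\<^sub>c) = {a, b}"
    if w: "w \<in> W" and 3: "card (f ` U (g w)) = 3" and abc: "f ` U (g w) = {a, b, c}" for w a b c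
  proof -
    \<comment> \<open>Heredity of \<open>V\<close> has to be applied to the preimages of
      \<open>a\<close>, \<open>b\<close> and \<open>c\<close>; injectivity of \<open>f\<close> turns
      the equation between images into one between the original sets.\<close>
    obtain a' b' c' where *: "a' \<in> U (g w)" "b' \<in> U (g w)" "c' \<in> U (g w)"
      "a = f a'" "b = f b'" "c = f c'"
    proof -
      have "a \<in> f ` U (g w)" "b \<in> f ` U (g w)" "c \<in> f ` U (g w)" unfolding abc by simp_all
      then show ?thesis using that by blast
    qed
    have "f ` U (g w) = f ` {a', b', c'}" unfolding abc *(4-6) by simp
    then have "U (g w) = {a', b', c'}"
      using inj_on_image_eq_iff[OF f'[OF gW[OF w]], of "U (g w)" "{a', b', c'}"] *(1-3) by simp
    moreover have "card (U (g w)) = 3" using card[OF gW[OF w]] 3 by simp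
    ultimately obtain v\<^sub>a v\<^sub>b v\<^sub>c where "v\<^sub>a \<in> V" "v\<^sub>b \<in> V" "v\<^sub>c \<in> V"
      "U v\<^sub>a = {b', c'}" "U v\<^sub>b = {a', c'}" "U v\<^sub>c = {a', b'}"
      using V gW[OF w] unfolding hereditary_23_collection_def by metis
    moreover obtain w\<^sub>a w\<^sub>b w\<^sub>c where "w\<^sub>a \<in> W" "w\<^sub>b \<in> W" "w\<^sub>c \<in> W" "g w\<^sub>a = v\<^sub>a" "g w\<^sub>b = v\<^sub>b" "g w\<^sub>c = v\<^sub>c"
      using Vg calculation(1-3) by meson
    ultimately show ?thesis
      using *(4-6) by (intro bexI[of _ w\<^sub>a] bexI[of _ w\<^sub>b] bexI[of _ w\<^sub>c]) simp_all
  qed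
  moreover have "finite W"
    using bij_betw_finite[OF g] V by (simp add: hereditary_23_collection_def)
  moreover have "\<forall>w \<in> W. card (f ` U (g w)) = 2 \<or> card (f ` U (g w)) = 3"
    using V gW card unfolding hereditary_23_collection_def by simp
  ultimately show ?thesis
    unfolding hereditary_23_collection_def by blast
qed

lemma intersection_graph_simps [simp]:
  "wverts (intersection_graph V U) = V"
  "multiplicity (intersection_graph V U) x y = (if x = y then 0 else card (U x \<inter> U y))"
  "weight (intersection_graph V U) x = card (U x) - 1"
  by (simp_all add: intersection_graph_def)

lemma inj_on_position: "inj_on (position xs) (set xs)"
  by (rule inj_onI) (simp add: position_inj)

text \<open>There are two renamings: vertices become their positions in \<open>xs\<close>, and set
  elements are sent to numbers by an injection, which preserves the cardinalities behind weights and
  multiplicities. As codes list everything by position, the code is literally the same tree.\<close>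

lemma intersection_graph_nat:
  fixes V :: "'v set" and U :: "'v \<Rightarrow> 'e set"
  assumes V: "hereditary_23_collection V U" and xs: "enumerates xs V"
  obtains G' :: "nat weighted_multigraph" where
    "([0..<length xs], G') \<in> instances wMIS"
    "code_weighted_multigraph [0..<length xs] G' = code_weighted_multigraph xs (intersection_graph V U)"
    "wverts G' = position xs ` V"
    "\<And>I. I \<subseteq> V \<Longrightarrow> independent G' (position xs ` I) \<longleftrightarrow> independent (intersection_graph V U) I"
    "\<And>x. x \<in> V \<Longrightarrow> weight G' (position xs x) = weight (intersection_graph V U) x"
proof -
  let ?n = "length xs" and ?G = "intersection_graph V U"
  have xs': "distinct xs" "set xs = V" using xs by (simp_all add: enumerates_def)
  have fin: "finite (U v)" if "v \<in> V" for v
    using V that by (fastforce simp: hereditary_23_collection_def intro: card_ge_0_finite)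
  then have "finite (\<Union> (U ` V))" using xs'(2) by auto
  from finite_imp_inj_to_nat_seg[OF this]
  obtain f :: "'e \<Rightarrow> nat" where f: "inj_on f (\<Union> (U ` V))" by auto
  define G' where "G' = intersection_graph {..<?n} (\<lambda>i. f ` U (xs ! i))"
  have f': "inj_on f S" if "S \<subseteq> \<Union> (U ` V)" for S
    using f that by (rule inj_on_subset)
  have card1: "card (f ` U v) = card (U v)" if "v \<in> V" for v
    using that by (intro card_image f') blast
  have card2: "card (f ` U v \<inter> f ` U w) = card (U v \<inter> U w)" if "v \<in> V" "w \<in> V" for v w
  proof -
    have "f ` U v \<inter> f ` U w = f ` (U v \<inter> U w)"
      using f that by (intro inj_on_image_Int[symmetric]) auto
    then show ?thesis using that card_image[OF f'[of "U v \<inter> U w"]] by auto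
  qed
  have nth: "xs ! i \<in> V" if "i < ?n" for i using that xs'(2) by auto
  have pos: "position xs x < ?n" "xs ! position xs x = x" if "x \<in> V" for x
    using that xs'(2) by (simp_all add: position_less nth_position)
  have mult: "multiplicity G' (position xs x) (position xs y) = multiplicity ?G x y"
    if "x \<in> V" "y \<in> V" for x y
    using that pos card2 xs'(2) by (simp add: G'_def position_inj)
  have weight: "weight G' (position xs x) = weight ?G x" if "x \<in> V" for x
    using that pos card1 by (simp add: G'_def)
  have "bij_betw (\<lambda>i. xs ! i) {..<?n} V"
    using bij_betw_nth[OF xs'(1)] xs'(2) by blast
  then have "hereditary_23_collection {..<?n} (\<lambda>i. f ` U (xs ! i))"
    using hereditary_image[OF V _ f] by blast
  then have inst: "([0..<?n], G') \<in> instances wMIS"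
    unfolding wMIS_def G'_def weighted_23_intersection_graph_def enumerates_def by auto
  have verts: "wverts G' = position xs ` V"
    unfolding G'_def using pos(1) position_nth[OF xs'(1)] nth
    by (auto simp: image_iff) (metis nth)
  have map_pos: "map h [0..<?n] = map (\<lambda>x. h (position xs x)) xs" for h :: "nat \<Rightarrow> val"
    by (rule nth_equalityI) (simp_all add: position_nth xs'(1))
  have code: "code_weighted_multigraph [0..<?n] G' = code_weighted_multigraph xs ?G"
    unfolding code_weighted_multigraph_def code_matrix_def code_vector_def map_pos
    by (intro arg_cong2[where f = Join] arg_cong[where f = code_list] map_cong refl
        arg_cong[where f = code_nat] weight mult) (simp_all add: xs'(2))
  have indep: "independent G' (position xs ` I) \<longleftrightarrow> independent ?G I" if "I \<subseteq> V" for I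
  proof -
    have eq: "position xs x = position xs y \<longleftrightarrow> x = y" if "x \<in> I" "y \<in> I" for x y
      using that \<open>I \<subseteq> V\<close> xs'(2) by (intro position_inj) auto
    have "(\<forall>x \<in> I. \<forall>y \<in> I. position xs x \<noteq> position xs y \<longrightarrow>
          multiplicity G' (position xs x) (position xs y) = 0) \<longleftrightarrow>
        (\<forall>x \<in> I. \<forall>y \<in> I. x \<noteq> y \<longrightarrow> multiplicity ?G x y = 0)"
      using eq mult that by (intro ball_cong refl) (metis subsetD)
    then show ?thesis
      unfolding independent_def verts ball_simps(9) using that by auto
  qed
  show ?thesis
    using that[OF inst code verts] indep weight by blast
qed

section \<open>Guarantees of the subroutine carried over from renamed graphs\<close>

lemma code_subset_nat:
  "distinct xs \<Longrightarrow> I \<subseteq> set xs \<Longrightarrow> code_subset [0..<length xs] (position xs ` I) = code_subset xs I"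
  unfolding code_subset_def code_vector_def
  by (intro arg_cong[where f = code_list] nth_equalityI)
    (auto simp: position_nth image_iff nth_position)

lemma code_subset_inj:
  assumes "code_subset xs I = code_subset xs J" "I \<subseteq> set xs" "J \<subseteq> set xs"
  shows "I = J"
proof -
  have "x \<in> I \<longleftrightarrow> x \<in> J" if "x \<in> set xs" for x
    using code_vector_inj[OF assms(1)[unfolded code_subset_def] that] by (simp add: of_bool_eq_iff)
  then show ?thesis using assms(2,3) by blast
qed

lemma returns_set_nat:
  assumes "enumerates xs V" "returns_set A xs (intersection_graph V U) I"
    and "code_weighted_multigraph [0..<length xs] G' = code_weighted_multigraph xs (intersection_graph V U)"
    and "wverts G' = position xs ` V"
  shows "returns_set A [0..<length xs] G' (position xs ` I)"
  using assms by (auto simp: returns_set_def enumerates_def code_subset_nat)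

lemma finite_independent: "finite (wverts G) \<Longrightarrow> finite {I. independent G I}"
  by (rule finite_subset[of _ "Pow (wverts G)"]) (auto simp: independent_def)

text \<open>The guarantee provides some good set with an execution on the renamed graph. That graph
  has the same code, execution is deterministic and subsets are determined by their codes, so the
  set actually returned is this good set up to renaming.\<close>

lemma approximation_program_returns:
  assumes A: "approximation_program \<alpha>
      (wMIS :: (nat list \<times> nat weighted_multigraph, nat set) maximization_problem) A"
    and \<alpha>: "\<alpha> > 0" and V: "hereditary_23_collection V U" and xs: "enumerates xs V"
    and I: "returns_set A xs (intersection_graph V U) I"
  shows "independent (intersection_graph V U) I"
    and "independent (intersection_graph V U) J \<Longrightarrow>
      1 / \<alpha> * (\<Sum>x \<in> J. real (card (U x) - 1)) \<le> (\<Sum>x \<in> I. real (card (U x) - 1))"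
proof -
  let ?G = "intersection_graph V U"
  obtain G' :: "nat weighted_multigraph" where G': "([0..<length xs], G') \<in> instances wMIS"
    "code_weighted_multigraph [0..<length xs] G' = code_weighted_multigraph xs ?G"
    "wverts G' = position xs ` V"
    "\<And>I. I \<subseteq> V \<Longrightarrow> independent G' (position xs ` I) \<longleftrightarrow> independent ?G I"
    "\<And>x. x \<in> V \<Longrightarrow> weight G' (position xs x) = weight ?G x"
    using intersection_graph_nat[OF V xs] by blast
  have xs': "distinct xs" "set xs = V" using xs by (simp_all add: enumerates_def)
  have IV: "I \<subseteq> V" using I by (simp add: returns_set_def)
  obtain s t where s: "approximates \<alpha> wMIS ([0..<length xs], G') s"
    "exec A (code_weighted_multigraph [0..<length xs] G') (code_subset [0..<length xs] s) t"
    using A G'(1) unfolding approximation_program_def by (fastforce simp: wMIS_def)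
  have indep_s: "independent G' s"
    using s(1) by (simp add: approximates_def wMIS_def)
  obtain t' where "exec A (code_weighted_multigraph xs ?G) (code_subset xs I) t'"
    using I by (auto simp: returns_set_def)
  with s(2) have "code_subset [0..<length xs] s = code_subset xs I"
    unfolding G'(2) using exec_deterministic by blast
  moreover have "position xs ` V \<subseteq> {0..<length xs}"
    unfolding xs'(2)[symmetric] by (auto simp: position_less)
  then have "s \<subseteq> {0..<length xs}" "position xs ` I \<subseteq> {0..<length xs}"
    using indep_s IV unfolding independent_def G'(3) by blast+
  ultimately have sI: "s = position xs ` I"
    using code_subset_inj[of "[0..<length xs]" s "position xs ` I"]
    by (simp add: code_subset_nat xs' IV)
  then show "independent ?G I" using indep_s G'(4)[OF IV] by simp
  have sum: "(\<Sum>x \<in> position xs ` K. weight G' x) = (\<Sum>x \<in> K. card (U x) - 1)" if "K \<subseteq> V" for K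
  proof -
    have "inj_on (position xs) K"
      using inj_on_position that unfolding xs'(2)[symmetric] by (rule inj_on_subset)
    then show ?thesis using that G'(5) by (simp add: sum.reindex subset_iff)
  qed
  assume J: "independent ?G J"
  then have JV: "J \<subseteq> V" by (simp add: independent_def)
  have "optimum wMIS ([0..<length xs], G') =
      Max ((\<lambda>I. real (\<Sum>x \<in> I. weight G' x)) ` {I. independent G' I})"
    by (simp add: optimum_def wMIS_def)
  moreover have "finite {I. independent G' I}"
    using G'(3) xs'(2) by (intro finite_independent) auto
  moreover have "position xs ` J \<in> {I. independent G' I}"
    using G'(4)[OF JV] J by simp
  ultimately have "real (\<Sum>x \<in> J. card (U x) - 1) \<le> optimum wMIS ([0..<length xs], G')"
    unfolding sum[OF JV, symmetric] by (auto intro!: Max_ge)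
  then have "1 / \<alpha> * real (\<Sum>x \<in> J. card (U x) - 1) \<le> 1 / \<alpha> * optimum wMIS ([0..<length xs], G')"
    using \<alpha> by (intro mult_left_mono) auto
  also have "\<dots> \<le> real (\<Sum>x \<in> s. weight G' x)"
    using s(1) by (simp add: approximates_def wMIS_def)
  finally show "1 / \<alpha> * (\<Sum>x \<in> J. real (card (U x) - 1)) \<le> (\<Sum>x \<in> I. real (card (U x) - 1))"
    unfolding sI sum[OF IV] by simp
qed

text \<open>The polynomial is fixed before the collection, hence uniform: renaming leaves the code,
  and with it the input size, unchanged.\<close>

lemma approximation_program_time:
  assumes A: "approximation_program \<alpha>
      (wMIS :: (nat list \<times> nat weighted_multigraph, nat set) maximization_problem) A"
  obtains p :: "nat poly" where "\<And>V U xs. hereditary_23_collection V U \<Longrightarrow> enumerates xs V \<Longrightarrow>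
    \<exists>I \<subseteq> V. \<exists>t \<le> poly p (size (code_weighted_multigraph xs (intersection_graph V U))).
      exec A (code_weighted_multigraph xs (intersection_graph V U)) (code_subset xs I) t"
proof -
  let ?Q = "wMIS :: (nat list \<times> nat weighted_multigraph, nat set) maximization_problem"
  obtain p :: "nat poly" where p: "\<And>i. i \<in> instances ?Q \<Longrightarrow> \<exists>s t. approximates \<alpha> ?Q i s \<and>
      exec A (code_input ?Q i) (code_output ?Q i s) t \<and> t \<le> poly p (size (code_input ?Q i))"
    using A unfolding approximation_program_def by blast
  show ?thesis
  proof (rule that)
    fix V U xs assume V: "hereditary_23_collection V U" and xs: "enumerates xs V"
    let ?G = "intersection_graph V U"
    obtain G' :: "nat weighted_multigraph" where G': "([0..<length xs], G') \<in> instances wMIS"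
      "code_weighted_multigraph [0..<length xs] G' = code_weighted_multigraph xs ?G"
      "wverts G' = position xs ` V"
      using intersection_graph_nat[OF V xs] by metis
    obtain s t where s: "independent G' s"
      "exec A (code_weighted_multigraph xs ?G) (code_subset [0..<length xs] s) t"
      "t \<le> poly p (size (code_weighted_multigraph xs ?G))"
      using p[OF G'(1)] by (auto simp: wMIS_def approximates_def G'(2))
    then obtain I where I: "I \<subseteq> V" "s = position xs ` I"
      using G'(3) by (auto simp: independent_def subset_image_iff)
    then have "code_subset [0..<length xs] s = code_subset xs I"
      using xs by (simp add: enumerates_def code_subset_nat)
    with s I(1) show "\<exists>I \<subseteq> V. \<exists>t \<le> poly p (size (code_weighted_multigraph xs ?G)).
        exec A (code_weighted_multigraph xs ?G) (code_subset xs I) t"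
      by auto
  qed
qed

text \<open>Injectivity makes the renaming commute with exchanging \<open>x\<close> for
  \<open>y\<close>, so the property known for graphs on numbers pulls back.\<close>

lemma exchange_optimal_returns:
  assumes A: "exchange_optimal A"
    and V: "hereditary_23_collection V U" and xs: "enumerates xs V"
    and I: "returns_set A xs (intersection_graph V U) I"
    and x: "x \<in> I" and y: "y \<in> V - I"
    and indep: "independent (intersection_graph V U) (insert y (I - {x}))"
  shows "card (U y) - 1 \<le> card (U x) - 1"
proof -
  let ?G = "intersection_graph V U"
  obtain G' :: "nat weighted_multigraph" where G': "([0..<length xs], G') \<in> instances wMIS"
    "code_weighted_multigraph [0..<length xs] G' = code_weighted_multigraph xs ?G"
    "wverts G' = position xs ` V"
    "\<And>I. I \<subseteq> V \<Longrightarrow> independent G' (position xs ` I) \<longleftrightarrow> independent ?G I"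
    "\<And>x. x \<in> V \<Longrightarrow> weight G' (position xs x) = weight ?G x"
    using intersection_graph_nat[OF V xs] by blast
  have IV: "I \<subseteq> V" using I by (simp add: returns_set_def)
  have inj: "inj_on (position xs) V"
    using xs inj_on_position[of xs] by (simp add: enumerates_def)
  let ?p = "position xs"
  have "?p ` (insert y (I - {x})) = insert (?p y) (?p ` I - {?p x})"
    using inj IV x by (auto simp: inj_on_def)
  then have "independent G' (insert (?p y) (?p ` I - {?p x}))"
    using G'(4)[of "insert y (I - {x})"] indep IV y by auto
  moreover have "?p y \<in> wverts G' - ?p ` I"
    using G'(3) y IV inj by (auto simp: inj_on_def)
  moreover have "?p x \<in> ?p ` I" using x by simp
  ultimately have "weight G' (?p y) \<le> weight G' (?p x)"
    using A G'(1) returns_set_nat[OF xs I G'(2,3)] unfolding exchange_optimal_def by blast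
  then show ?thesis using G'(5) x y IV by auto
qed

text \<open>A set of size 3 must belong to a candidate \<open>(v, None)\<close>, as
  \<open>(v, Some u)\<close> stands for three heads minus one. The three candidates
  \<open>(v, Some u)\<close> of the same node then supply its pairs.\<close>

lemma (in enumerated_digraph) hereditary_candidates:
  assumes "pverts D = set vs"
  shows "hereditary_23_collection (candidates D F) (candidate_set D F)"
proof -
  have "finite (candidates D F)"
    using enumerates_candidate_list[OF assms, of F] unfolding enumerates_def
    by (metis List.finite_set)
  moreover have fin: "finite (free_heads D F v)" for v
    using free_heads_subset by (rule finite_subset) simp
  moreover have "card (candidate_set D F x) = 2 \<or> card (candidate_set D F x) = 3"
    if "x \<in> candidates D F" for x
    using that unfolding candidates_def
    by (elim UnE CollectE exE conjE) (auto simp: fin)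
  moreover have "\<exists>x\<^sub>a \<in> candidates D F. \<exists>x\<^sub>b \<in> candidates D F. \<exists>x\<^sub>c \<in> candidates D F.
      candidate_set D F x\<^sub>a = {b, c} \<and> candidate_set D F x\<^sub>b = {a, c} \<and> candidate_set D F x\<^sub>c = {a, b}"
    if x: "x \<in> candidates D F" and 3: "card (candidate_set D F x) = 3"
      and abc: "candidate_set D F x = {a, b, c}" for x a b c
  proof -
    obtain v where v: "x = (v, None)"
      using x 3 fin unfolding candidates_def by (elim UnE CollectE exE conjE) auto
    then have U: "free_heads D F v = {a, b, c}" using abc by simp
    have "(v, Some u) \<in> candidates D F" if "u \<in> {a, b, c}" for u
      using x v U 3 that unfolding candidates_def by simp
    then have *: "(v, Some a) \<in> candidates D F" "(v, Some b) \<in> candidates D F"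
      "(v, Some c) \<in> candidates D F" by blast+
    have "distinct [a, b, c]"
      using 3 abc card_distinct[of "[a, b, c]"] by simp
    then have "candidate_set D F (v, Some a) = {b, c}" "candidate_set D F (v, Some b) = {a, c}"
      "candidate_set D F (v, Some c) = {a, b}"
      unfolding candidate_set.simps U by auto
    with * show ?thesis by blast
  qed
  ultimately show ?thesis unfolding hereditary_23_collection_def by blast
qed

section \<open>Arborescences in rooted dags\<close>

lemma root_reaches:
  assumes "pair_wf_digraph T" "root T r" "v \<in> pverts T" "v \<noteq> r"
  shows "(r, v) \<in> (parcs T)\<^sup>+"
proof -
  interpret T: pair_wf_digraph T by (rule assms(1))
  obtain p where p: "T.apath r p v"
    using assms(2,3) by (auto simp: root_def)
  then have "T.awalk r p v" by (rule T.awalkI_apath)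
  moreover from this assms(4) have "p \<noteq> []" by (auto simp: T.awalk_Nil_iff)
  ultimately show ?thesis by (rule T.reachable1_awalkI)
qed

lemma root_parent:
  assumes "pair_wf_digraph T" "root T r" "v \<in> pverts T" "v \<noteq> r"
  shows "\<exists>u. (u, v) \<in> parcs T"
  using tranclD2[OF root_reaches[OF assms]] by blast

locale dag_with_root =
  fixes D :: "'a pair_pre_digraph" and r :: 'a
  assumes dag: "rooted_dag D" and root: "root D r"
begin

sublocale D: pair_fin_digraph D
  using dag by (simp add: rooted_dag_def)

text \<open>A nonempty closed walk contains a cycle. This leads from the walk-based notion of a dag
  to the arc relation, along which induction becomes possible.\<close>

lemma acyclic_D: "acyclic (parcs D)"
proof (rule acyclicI, rule allI, rule notI)
  fix x assume "(x, x) \<in> (parcs D)\<^sup>+"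
  then obtain p where "D.awalk x p x" "p \<noteq> []"
    unfolding D.reachable1_awalk by blast
  then have "D.closed_w p" by (auto simp: D.closed_w_def)
  then have "\<exists>p. D.cycle p" by (rule D.closed_w_imp_cycle)
  then show False using dag by (simp add: rooted_dag_def dag_def)
qed

lemma root_in: "r \<in> pverts D"
  using root by (simp add: root_def)

text \<open>The root reaches the tail of such an arc, which would close a cycle. Consequently only
  \<open>r\<close> can be the root of a spanning arborescence.\<close>

lemma no_arc_to_root: "(u, r) \<notin> parcs D"
proof
  assume u: "(u, r) \<in> parcs D"
  then have "(r, u) \<in> (parcs D)\<^sup>*"
    using root_reaches[OF D.pair_wf_digraph_axioms root, of u] D.in_arcsD1[OF u] by (cases "u = r") auto
  with u have "(r, r) \<in> (parcs D)\<^sup>+" by (rule rtrancl_into_trancl1[rotated])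
  then show False using acyclic_D by (auto simp: acyclic_def)
qed

lemma parent_in_D: "v \<in> pverts D \<Longrightarrow> v \<noteq> r \<Longrightarrow> \<exists>u. (u, v) \<in> parcs D"
  by (rule root_parent[OF D.pair_wf_digraph_axioms root])

text \<open>Inside an acyclic digraph, in-degree at most one already makes the components
  arborescences, so no condition on paths appears.\<close>

definition branching_in :: "'a pair_pre_digraph \<Rightarrow> bool" where
  "branching_in F \<longleftrightarrow> pverts F = pverts D \<and> parcs F \<subseteq> parcs D \<and>
     (\<forall>u v w. (u, w) \<in> parcs F \<longrightarrow> (v, w) \<in> parcs F \<longrightarrow> u = v)"

lemma branching_in_finite: "branching_in F \<Longrightarrow> finite (parcs F)"
  unfolding branching_in_def using D.pair_finite_arcs finite_subset by blast

lemma finite_Domain: "branching_in F \<Longrightarrow> finite (Domain (parcs F))"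
  using branching_in_finite finite_Domain by blast

lemma free_heads_branching:
  "branching_in F \<Longrightarrow> u \<in> free_heads D F v \<longleftrightarrow> (v, u) \<in> parcs D \<and> u \<notin> Range (parcs F)"
  using in_degree_eq_0_iff[OF branching_in_finite] by (auto simp: free_heads_def)

lemma out_degree_branching: "branching_in F \<Longrightarrow> out_degree F v = 0 \<longleftrightarrow> v \<notin> Domain (parcs F)"
  using out_degree_eq_0_iff[OF branching_in_finite] by auto

lemma finite_free_heads: "finite (free_heads D F v)"
  by (rule finite_subset[OF _ D.pair_finite_verts]) (auto simp: free_heads_def dest: D.in_arcsD2)

text \<open>Following parents in a finite dag ends at the only node without one, the root, which
  yields a walk to every node. Uniqueness is shown for walks by peeling off last arcs: the last arc
  is determined by its head, and no arc enters the root.\<close>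

lemma spanning_arborescenceI:
  assumes T: "branching_in T"
    and parent: "\<And>v. v \<in> pverts D \<Longrightarrow> v \<noteq> r \<Longrightarrow> v \<in> Range (parcs T)"
  shows "arborescence T \<and> spanning T D"
proof -
  have T': "pverts T = pverts D" "parcs T \<subseteq> parcs D"
    "\<And>u v w. (u, w) \<in> parcs T \<Longrightarrow> (v, w) \<in> parcs T \<Longrightarrow> u = v"
    using T by (auto simp: branching_in_def)
  interpret T: pair_fin_digraph T
    using T'(1,2) branching_in_finite[OF T] D.pair_finite_verts
    by unfold_locales (auto dest: D.arc_fst_in_verts D.arc_snd_in_verts)
  have "\<exists>p. T.awalk r p v" if "v \<in> pverts D" for v
  proof -
    have "wf (parcs D)" by (rule finite_acyclic_wf[OF D.pair_finite_arcs acyclic_D])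
    then show ?thesis using that
    proof (induction v rule: wf_induct_rule)
      case (less v)
      show ?case
      proof (cases "v = r")
        case True
        then show ?thesis using T'(1) root_in by (metis T.awalk_Nil_iff)
      next
        case False
        then obtain u where u: "(u, v) \<in> parcs T" using parent[OF less.prems] by blast
        then have "u \<in> pverts D" "(u, v) \<in> parcs D" using T'(2) by (auto dest: D.in_arcsD1)
        then obtain p where p: "T.awalk r p u" using less.IH by blast
        have "T.awalk u [(u, v)] v"
          using T.arc_implies_awalk[OF u] by simp
        then show ?thesis using T.awalk_appendI[OF p] by blast
      qed
    qed
  qed
  then have ex: "\<exists>p. T.apath r p v" if "v \<in> pverts T" for v
    using that T'(1) T.apath_awalk_to_apath by metis
  have unique: "p = q" if "T.awalk r p v" "T.awalk r q v" for p q v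
    using that
  proof (induction p arbitrary: q v rule: rev_induct)
    case Nil
    then have v: "v = r" by (simp add: T.awalk_Nil_iff)
    show ?case
    proof (cases q rule: rev_cases)
      case (snoc q' e)
      then have "e \<in> parcs D" "snd e = r"
        using Nil.prems(2) v T'(2) by (auto simp: T.awalk_simps)
      then show ?thesis using no_arc_to_root by (cases e) auto
    qed simp
  next
    case (snoc e p)
    then have e: "e \<in> parcs T" "snd e = v" "T.awalk r p (fst e)"
      by (auto simp: T.awalk_simps)
    show ?case
    proof (cases q rule: rev_cases)
      case Nil
      then have "v = r" using snoc.prems by (simp add: T.awalk_Nil_iff)
      then show ?thesis using e T'(2) no_arc_to_root by (cases e) auto
    next
      case (snoc q' e')
      then have e': "e' \<in> parcs T" "snd e' = v" "T.awalk r q' (fst e')"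
        using snoc.prems by (auto simp: T.awalk_simps)
      then have "e = e'" using e T'(3) by (metis prod.collapse)
      with e(3) e'(3) snoc.IH snoc show ?thesis by auto
    qed
  qed
  have "arborescence T"
    unfolding arborescence_def
  proof (intro conjI exI ballI)
    show "root T r" using root_in ex by (simp add: root_def T'(1))
    show "\<exists>!p. T.apath r p v" if "v \<in> pverts T" for v
      using ex[OF that] unique T.awalkI_apath by metis
  qed (rule T.pair_fin_digraph)
  moreover have "spanning T D"
    using T'(1,2) T.wf_digraph D.wf_digraph
    by (auto simp: spanning_def subgraph_def compatible_def)
  ultimately show ?thesis ..
qed

text \<open>If the root of \<open>T\<close> differed from \<open>r\<close>, some arc of
  \<open>T\<close>, and hence of \<open>D\<close>, would enter \<open>r\<close>.\<close>

lemma spanning_arborescence_parent: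
  assumes "arborescence T" "spanning T D"
  shows "pverts T = pverts D" "parcs T \<subseteq> parcs D"
    and "v \<in> pverts D \<Longrightarrow> v \<noteq> r \<Longrightarrow> \<exists>u. (u, v) \<in> parcs T"
proof -
  show T: "pverts T = pverts D" "parcs T \<subseteq> parcs D"
    using assms(2) by (auto simp: spanning_def subgraph_def)
  obtain r' where r': "root T r'" and wf: "pair_wf_digraph T"
    using assms(1) by (auto simp: arborescence_def pair_fin_digraph_def)
  have "r' = r"
    using root_parent[OF wf r', of r] root_in T no_arc_to_root by blast
  then show "v \<in> pverts D \<Longrightarrow> v \<noteq> r \<Longrightarrow> \<exists>u. (u, v) \<in> parcs T"
    using root_parent[OF wf r'] T(1) by simp
qed

lemma leaves_eq: "finite (parcs T) \<Longrightarrow> leaves T = pverts T - Domain (parcs T)"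
  unfolding leaves_def by (auto simp: out_degree_eq_0_iff)


section \<open>Greedy expansion\<close>

text \<open>The inequality says that \<open>t\<close> times the number of newly expanded nodes is at
  most the number of new arcs; it is written with sums because subtraction of naturals truncates. As
  a relation between start and end it composes and serves both passes.\<close>

definition expansion :: "nat \<Rightarrow> 'a pair_pre_digraph \<Rightarrow> 'a pair_pre_digraph \<Rightarrow> bool" where
  "expansion t F F' \<longleftrightarrow> branching_in F' \<and> parcs F \<subseteq> parcs F' \<and>
     t * card (Domain (parcs F')) + card (parcs F) \<le> t * card (Domain (parcs F)) + card (parcs F') \<and>
     (\<forall>v \<in> Domain (parcs F') - Domain (parcs F). free_heads D F' v = {})"

lemma free_heads_antimono:
  assumes "branching_in F" "branching_in F'" "parcs F \<subseteq> parcs F'"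
  shows "free_heads D F' v \<subseteq> free_heads D F v"
  using Range_mono[OF assms(3)]
  unfolding subset_iff free_heads_branching[OF assms(1)] free_heads_branching[OF assms(2)]
  by blast

lemma expansion_refl: "branching_in F \<Longrightarrow> expansion t F F"
  by (simp add: expansion_def)

text \<open>Saturation reached in the first part survives the second because free heads only
  disappear.\<close>

lemma expansion_trans:
  assumes "expansion t F F'" "expansion t F' F''"
  shows "expansion t F F''"
  using assms free_heads_antimono[of F' F''] unfolding expansion_def
  by (safe, auto) blast

text \<open>An expansion makes at most one node internal and adds arcs to all its free heads, after
  which every out-neighbour of it in \<open>D\<close> is covered.\<close>

lemma expansion_greedy_step:
  assumes F: "branching_in F"
  shows "expansion t F (greedy_step D t v F)"
proof (cases "v \<notin> Domain (parcs F) \<and> t \<le> card (free_heads D F v)")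
  case True
  let ?U = "free_heads D F v"
  let ?F = "F\<lparr>parcs := parcs F \<union> {(v, u) | u. u \<in> ?U}\<rparr>"
  have step: "greedy_step D t v F = ?F"
    unfolding greedy_step_eq using True out_degree_branching[OF F] by simp
  have U: "u \<in> ?U \<longleftrightarrow> (v, u) \<in> parcs D \<and> u \<notin> Range (parcs F)" for u
    by (rule free_heads_branching[OF F])
  have F': "branching_in ?F"
    using F U unfolding branching_in_def by auto
  have "card (parcs ?F) = card (parcs F) + card {(v, u) | u. u \<in> ?U}"
    using True branching_in_finite[OF F] finite_subset[OF _ branching_in_finite[OF F'], of "{(v, u) | u. u \<in> ?U}"]
    by (simp, intro card_Un_disjoint) auto
  then have "card (parcs ?F) \<ge> card (parcs F) + t"
    using True by (simp add: card_pairs)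
  moreover have "card (Domain (parcs ?F)) \<le> card (Domain (parcs F)) + 1"
  proof -
    have "card (Domain (parcs ?F)) \<le> card (insert v (Domain (parcs F)))"
      by (rule card_mono) (use finite_Domain[OF F] in auto)
    also have "\<dots> \<le> card (Domain (parcs F)) + 1" by (simp add: card_insert_le_m1 card_insert_if finite_Domain[OF F])
    finally show ?thesis .
  qed
  then have "t * card (Domain (parcs ?F)) \<le> t * (card (Domain (parcs F)) + 1)"
    by (rule mult_le_mono2)
  moreover have "free_heads D ?F w = {}" if "w \<in> Domain (parcs ?F) - Domain (parcs F)" for w
  proof -
    have "w = v" using that by auto
    moreover have "u \<in> Range (parcs ?F)" if "(v, u) \<in> parcs D" for u
      using U[of u] that by (cases "u \<in> Range (parcs F)") auto
    ultimately show ?thesis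
      using free_heads_branching[OF F', of _ v] by blast
  qed
  ultimately show ?thesis
    unfolding step expansion_def using F' by simp
next
  case False
  then have "greedy_step D t v F = F"
    unfolding greedy_step_eq using out_degree_branching[OF F] by auto
  then show ?thesis using expansion_refl[OF F] by simp
qed

lemma expansion_greedy_expand:
  "branching_in F \<Longrightarrow> expansion t F (greedy_expand D t vs F)"
  unfolding greedy_expand_def
proof (induction vs arbitrary: F)
  case (Cons v vs)
  have "expansion t F (greedy_step D t v F)"
    by (rule expansion_greedy_step) (rule Cons.prems)
  moreover from this have "expansion t (greedy_step D t v F) (fold (greedy_step D t) vs (greedy_step D t v F))"
    by (intro Cons.IH) (simp add: expansion_def)
  ultimately show ?case by (auto intro: expansion_trans)
qed (simp add: expansion_refl)

lemma expansion_mono: "expansion t F F' \<Longrightarrow> branching_in F \<Longrightarrow>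
    v \<in> Domain (parcs F) \<or> card (free_heads D F v) < t \<Longrightarrow>
    v \<in> Domain (parcs F') \<or> card (free_heads D F' v) < t"
  unfolding expansion_def
  using card_mono[OF finite_free_heads free_heads_antimono, of F F' v] by auto

text \<open>For \<open>t\<close> at least 1, an expansion adds an arc and thereby puts
  \<open>v\<close> into the domain.\<close>

lemma greedy_step_blocked:
  assumes F: "branching_in F" and t: "t \<ge> 1"
  shows "v \<in> Domain (parcs (greedy_step D t v F)) \<or> card (free_heads D (greedy_step D t v F) v) < t"
proof -
  have "free_heads D F v \<noteq> {}" if "t \<le> card (free_heads D F v)"
    using that t by auto
  then show ?thesis
    unfolding greedy_step_eq out_degree_branching[OF F] by auto
qed

text \<open>When a node is visited it is internal or blocked afterwards, and this is permanent since
  sets of free heads only shrink. So one pass suffices, in any order.\<close>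

lemma greedy_expand_blocked:
  assumes "branching_in F" "t \<ge> 1" "v \<in> set vs"
  shows "v \<in> Domain (parcs (greedy_expand D t vs F)) \<or>
    card (free_heads D (greedy_expand D t vs F) v) < t"
  using assms(1,3) unfolding greedy_expand_def
proof (induction vs arbitrary: F)
  case (Cons w vs)
  let ?F = "greedy_step D t w F"
  have F: "branching_in ?F"
    using expansion_greedy_step[OF Cons.prems(1), of t w] by (simp add: expansion_def)
  show ?case
  proof (cases "v \<in> set vs")
    case True
    then show ?thesis using Cons.IH[OF F] by simp
  next
    case False
    then have "v = w" using Cons.prems(2) by simp
    then have "v \<in> Domain (parcs ?F) \<or> card (free_heads D ?F v) < t"
      using greedy_step_blocked[OF Cons.prems(1) assms(2)] by simp
    then show ?thesis
      using expansion_mono[OF expansion_greedy_expand[OF F, unfolded greedy_expand_def] F] by simp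
  qed
qed simp

end

section \<open>The approximation guarantee\<close>

text \<open>Multiplicities are cardinalities, and an infinite intersection would also count as 0;
  for finite sets multiplicity 0 is disjointness.\<close>

lemma independent_intersection_graph:
  assumes "\<And>x. x \<in> V \<Longrightarrow> finite (U x)"
  shows "independent (intersection_graph V U) I \<longleftrightarrow> I \<subseteq> V \<and> disjoint_family_on U I"
  unfolding independent_def disjoint_family_on_def intersection_graph_simps
  using assms by (intro conj_cong ball_cong refl) (auto simp: subset_iff)

context dag_with_root
begin

lemma finite_candidate_set: "finite (candidate_set D F x)"
  using finite_free_heads by (cases "(D, F, x)" rule: candidate_set.cases) auto

lemma independent_candidates:
  "independent (intersection_graph (candidates D F) (candidate_set D F)) I \<longleftrightarrow>
     I \<subseteq> candidates D F \<and> disjoint_family_on (candidate_set D F) I"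
  by (rule independent_intersection_graph) (rule finite_candidate_set)

lemma candidate_set_free: "candidate_set D F x \<subseteq> free_heads D F (fst x)"
  by (cases "(D, F, x)" rule: candidate_set.cases) auto

lemma card_candidate_set: "x \<in> candidates D F \<Longrightarrow> card (candidate_set D F x) \<in> {2, 3}"
  unfolding candidates_def by (elim UnE CollectE exE conjE) (auto simp: finite_free_heads)

lemma finite_candidates: "finite (candidates D F)"
proof -
  have "candidates D F \<subseteq> pverts D \<times> insert None (Some ` pverts D)"
    unfolding candidates_def free_heads_def using D.in_arcsD2 by fastforce
  then show ?thesis by (rule finite_subset) (simp add: D.pair_finite_verts)
qed

text \<open>The children that the nodes of an arborescence have among the uncovered nodes form sets
  of candidates as soon as there are at least two of them.\<close>

lemma leaves_upper_bound:
  assumes F: "branching_in F"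
    and saturated: "\<And>v. v \<in> Domain (parcs F) \<Longrightarrow> free_heads D F v = {}"
    and small: "\<And>v. v \<in> pverts D \<Longrightarrow> card (free_heads D F v) \<le> 3"
    and T: "arborescence T" "spanning T D"
  obtains J where "independent (intersection_graph (candidates D F) (candidate_set D F)) J"
    "card (leaves T) \<le> 1 + card (parcs F) + (\<Sum>x \<in> J. card (candidate_set D F x) - 1)"
proof -
  note T_arcs = spanning_arborescence_parent[OF T]
  obtain p where p: "\<And>v. v \<in> pverts D \<Longrightarrow> v \<noteq> r \<Longrightarrow> (p v, v) \<in> parcs T"
    using T_arcs(3) by metis
  \<comment> \<open>\<open>R\<close> consists of the nodes that \<open>T\<close> covers beyond
    \<open>F\<close>, \<open>B\<close> sorts them by their parent in \<open>T\<close>, and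
    \<open>P\<close> collects the parents of at least two of them, the only ones with positive
    weight.\<close>
  define R where "R = pverts D - {r} - Range (parcs F)"
  define B where "B v = {u \<in> R. p u = v}" for v
  define P where "P = {v \<in> p ` R. 2 \<le> card (B v)}"
  have finV: "finite (pverts D)" by (rule D.pair_finite_verts)
  then have finR: "finite R" by (simp add: R_def)
  have finB: "finite (B v)" for v using finR by (simp add: B_def)
  have p_in: "p u \<in> pverts D" "(p u, u) \<in> parcs D" "(p u, u) \<in> parcs T" if "u \<in> R" for u
    using p[of u] that T_arcs(2) by (auto simp: R_def dest: D.in_arcsD1)
  have B_free: "B v \<subseteq> free_heads D F v" for v
    using p_in(2) by (auto simp: B_def R_def free_heads_branching[OF F])
  have B_pos: "1 \<le> card (B v)" if "v \<in> p ` R" for v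
    using that finB[of v] by (auto simp: B_def Suc_le_eq card_gt_0_iff)
  \<comment> \<open>A parent of m nodes of \<open>R\<close> contributes 1 + (m - 1). The ones count
    internal nodes of \<open>T\<close>; the rest becomes the weight of the independent set.\<close>
  have "card R = (\<Sum>v \<in> p ` R. card (B v))"
    using sum.image_gen[OF finR, of "\<lambda>_. 1::nat" p] by (simp add: B_def)
  also have "\<dots> = (\<Sum>v \<in> p ` R. 1 + (card (B v) - 1))"
    by (intro sum.cong refl, rule le_add_diff_inverse[symmetric]) (rule B_pos)
  also have "\<dots> = card (p ` R) + (\<Sum>v \<in> p ` R. card (B v) - 1)"
    by (simp only: sum.distrib card_eq_sum)
  also have "(\<Sum>v \<in> p ` R. card (B v) - 1) = (\<Sum>v \<in> P. card (B v) - 1)"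
    unfolding P_def using finR by (intro sum.mono_neutral_right) (auto simp: not_le)
  finally have card_R: "card R = card (p ` R) + (\<Sum>v \<in> P. card (B v) - 1)" .
  have "card (leaves T) + card (p ` R) \<le> card (pverts D)"
  proof -
    have "leaves T \<inter> p ` R = {}"
      using p_in(3) T_arcs(1,2) D.pair_finite_arcs finite_subset[OF T_arcs(2)]
      by (auto simp: leaves_eq)
    then have "card (leaves T) + card (p ` R) = card (leaves T \<union> p ` R)"
      using finV finR T_arcs(1) by (intro card_Un_disjoint[symmetric]) (auto simp: leaves_def)
    also have "\<dots> \<le> card (pverts D)"
      using finV p_in(1) T_arcs(1) by (intro card_mono) (auto simp: leaves_def)
    finally show ?thesis .
  qed
  moreover have "card (pverts D) \<le> 1 + card (parcs F) + card R"
  proof -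
    have "pverts D \<subseteq> insert r (Range (parcs F) \<union> R)" by (auto simp: R_def)
    then have "card (pverts D) \<le> card (insert r (Range (parcs F) \<union> R))"
      using finR branching_in_finite[OF F] by (intro card_mono) (auto simp: finite_Range)
    also have "\<dots> \<le> Suc (card (Range (parcs F) \<union> R))" by (rule card_insert_le_m1) simp_all
    also have "\<dots> \<le> Suc (card (Range (parcs F)) + card R)" using card_Un_le by simp
    also have "card (Range (parcs F)) \<le> card (parcs F)"
      unfolding Range_snd using branching_in_finite[OF F] by (rule card_image_le)
    finally show ?thesis by simp
  qed
  ultimately have bound: "card (leaves T) \<le> 1 + card (parcs F) + (\<Sum>v \<in> P. card (B v) - 1)"
    using card_R by linarith
  have "\<exists>x. fst x = v \<and> x \<in> candidates D F \<and> candidate_set D F x = B v" if "v \<in> P" for v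
  proof -
    have v: "v \<in> pverts D" "2 \<le> card (B v)" using that p_in(1) by (auto simp: P_def)
    have "B v \<noteq> {}" using v(2) by auto
    then have not_expanded: "out_degree F v = 0"
      using saturated[of v] B_free[of v] by (auto simp: out_degree_branching[OF F])
    have le: "card (B v) \<le> card (free_heads D F v)"
      by (rule card_mono[OF finite_free_heads B_free])
    show ?thesis
    proof (cases "B v = free_heads D F v")
      case True
      then have "(v, None) \<in> candidates D F"
        using v small[OF v(1)] not_expanded by (simp add: candidates_def)
      with True show ?thesis by (intro exI[of _ "(v, None)"]) simp
    next
      case False
      then have "card (B v) < card (free_heads D F v)"
        using B_free by (intro psubset_card_mono[OF finite_free_heads]) auto
      then have 3: "card (free_heads D F v) = 3" "card (B v) = 2"
        using v small[OF v(1)] by auto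
      then have "card (free_heads D F v - B v) = 1"
        using card_Diff_subset[OF finB B_free, of v] by simp
      then obtain u where u: "free_heads D F v - B v = {u}"
        by (auto simp: card_1_singleton_iff)
      then have "(v, Some u) \<in> candidates D F"
        using v(1) 3(1) not_expanded by (auto simp: candidates_def)
      moreover have "free_heads D F v - {u} = B v" using u B_free by blast
      ultimately show ?thesis by (intro exI[of _ "(v, Some u)"]) simp
    qed
  qed
  then obtain c where c: "\<And>v. v \<in> P \<Longrightarrow> fst (c v) = v"
    "\<And>v. v \<in> P \<Longrightarrow> c v \<in> candidates D F" "\<And>v. v \<in> P \<Longrightarrow> candidate_set D F (c v) = B v"
    by metis
  have "inj_on c P" using c(1) by (metis inj_onI)
  then have "(\<Sum>x \<in> c ` P. card (candidate_set D F x) - 1) = (\<Sum>v \<in> P. card (B v) - 1)"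
    by (simp add: sum.reindex c(3))
  \<comment> \<open>Different parents have disjoint sets, since \<open>p\<close> picks one parent
    for each node.\<close>
  moreover have "independent (intersection_graph (candidates D F) (candidate_set D F)) (c ` P)"
    unfolding independent_candidates disjoint_family_on_def using c(2,3) by (auto simp: B_def)
  ultimately show ?thesis using that[of "c ` P"] bound by simp
qed

end

section \<open>Counting leaves in a run of the algorithm\<close>

locale maxleaves_run = dag_with_root D r for D :: "'a pair_pre_digraph" and r +
  fixes vs\<^sub>1 vs\<^sub>2 :: "'a list" and I :: "'a candidate set" and F\<^sub>1 F\<^sub>2 T :: "'a pair_pre_digraph"
  assumes vs: "set vs\<^sub>1 = pverts D" "set vs\<^sub>2 = pverts D"
    and F\<^sub>1: "F\<^sub>1 = greedy_expand D 4 vs\<^sub>1 \<lparr>pverts = pverts D, parcs = {}\<rparr>"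
    and I: "independent (intersection_graph (candidates D F\<^sub>1) (candidate_set D F\<^sub>1)) I"
    and F\<^sub>2: "F\<^sub>2 = F\<^sub>1\<lparr>parcs := parcs F\<^sub>1 \<union> {(fst x, u) | x u. x \<in> I \<and> u \<in> candidate_set D F\<^sub>1 x}\<rparr>"
    and T: "T = greedy_expand D 1 vs\<^sub>2 F\<^sub>2"
begin

abbreviation U :: "'a candidate \<Rightarrow> 'a set" where
  "U \<equiv> candidate_set D F\<^sub>1"

definition A :: "('a \<times> 'a) set" where
  "A = {(fst x, u) | x u. x \<in> I \<and> u \<in> U x}"

lemma expansion_F\<^sub>1: "expansion 4 \<lparr>pverts = pverts D, parcs = {}\<rparr> F\<^sub>1"
  unfolding F\<^sub>1 by (rule expansion_greedy_expand) (simp add: branching_in_def)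

lemma branching_F\<^sub>1: "branching_in F\<^sub>1"
  using expansion_F\<^sub>1 by (simp add: expansion_def)

lemma saturated_F\<^sub>1: "v \<in> Domain (parcs F\<^sub>1) \<Longrightarrow> free_heads D F\<^sub>1 v = {}"
  using expansion_F\<^sub>1 by (simp add: expansion_def)

lemma expanded_F\<^sub>1: "4 * card (Domain (parcs F\<^sub>1)) \<le> card (parcs F\<^sub>1)"
  using expansion_F\<^sub>1 by (simp add: expansion_def)

lemma small_F\<^sub>1:
  assumes "v \<in> pverts D"
  shows "card (free_heads D F\<^sub>1 v) \<le> 3"
proof (cases "v \<in> Domain (parcs F\<^sub>1)")
  case True
  then show ?thesis by (simp add: saturated_F\<^sub>1)
next
  case False
  have "branching_in \<lparr>pverts = pverts D, parcs = {}\<rparr>" by (simp add: branching_in_def)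
  from greedy_expand_blocked[OF this, of 4 v vs\<^sub>1] False show ?thesis
    using vs(1) assms unfolding F\<^sub>1[symmetric] by simp
qed

lemma I': "I \<subseteq> candidates D F\<^sub>1" "disjoint_family_on U I"
  using I unfolding independent_candidates by auto

lemma finite_I: "finite I"
  using I'(1) finite_candidates by (rule finite_subset)

lemma parcs_F\<^sub>2: "parcs F\<^sub>2 = parcs F\<^sub>1 \<union> A"
  unfolding F\<^sub>2 A_def by simp

lemma A_free: "(v, u) \<in> A \<Longrightarrow> (v, u) \<in> parcs D \<and> u \<notin> Range (parcs F\<^sub>1)"
  unfolding A_def using candidate_set_free[of F\<^sub>1] free_heads_branching[OF branching_F\<^sub>1] by blast

text \<open>Selected candidates have disjoint sets, so a head alone determines the candidate it
  comes from and no arc is counted twice.\<close>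

lemma card_A: "card A = (\<Sum>x \<in> I. card (U x))"
proof -
  have "A = (\<lambda>(x, u). (fst x, u)) ` Sigma I U"
    unfolding A_def by force
  moreover have "inj_on (\<lambda>(x, u). (fst x, u)) (Sigma I U)"
  proof (rule inj_onI)
    fix p q assume *: "p \<in> Sigma I U" "q \<in> Sigma I U"
      "(case p of (x, u) \<Rightarrow> (fst x, u)) = (case q of (x, u) \<Rightarrow> (fst x, u))"
    then have "snd p = snd q" by (auto split: prod.splits)
    moreover have "fst p \<in> I" "fst q \<in> I" "snd p \<in> U (fst p)" "snd q \<in> U (fst q)"
      using *(1,2) by auto
    ultimately have "fst p = fst q"
      using I'(2) unfolding disjoint_family_on_def by (metis disjoint_iff)
    with \<open>snd p = snd q\<close> show "p = q" by (simp add: prod_eq_iff)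
  qed
  ultimately show ?thesis
    using finite_I finite_candidate_set by (simp add: card_image)
qed

lemma branching_F\<^sub>2: "branching_in F\<^sub>2"
proof -
  have unique_A: "v = w" if vw: "(v, u) \<in> A" "(w, u) \<in> A" for v w u
  proof -
    obtain x y where xy: "x \<in> I" "y \<in> I" "u \<in> U x" "u \<in> U y" "v = fst x" "w = fst y"
      using vw unfolding A_def by blast
    then have "x = y"
      using I'(2) unfolding disjoint_family_on_def by (metis disjoint_iff)
    with xy show ?thesis by simp
  qed
  have "u = v" if "(u, w) \<in> parcs F\<^sub>1 \<union> A" "(v, w) \<in> parcs F\<^sub>1 \<union> A" for u v w
    using that unique_A[of u w v] A_free[of u w] A_free[of v w] branching_F\<^sub>1
    unfolding branching_in_def by blast
  moreover have "pverts F\<^sub>2 = pverts D" "parcs F\<^sub>1 \<union> A \<subseteq> parcs D"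
    using branching_F\<^sub>1 A_free by (auto simp: F\<^sub>2 branching_in_def)
  ultimately show ?thesis
    unfolding branching_in_def parcs_F\<^sub>2 by blast
qed

lemma expansion_T: "expansion 1 F\<^sub>2 T"
  unfolding T by (rule expansion_greedy_expand) (rule branching_F\<^sub>2)

lemma branching_T: "branching_in T"
  using expansion_T by (simp add: expansion_def)

lemma arcs_T: "parcs F\<^sub>1 \<subseteq> parcs T" "parcs F\<^sub>2 \<subseteq> parcs T"
  using expansion_T by (auto simp: expansion_def parcs_F\<^sub>2)

text \<open>With threshold 1 a blocked node has no free head at all. Hence every in-neighbour of a
  node left uncovered is already internal.\<close>

lemma blocked_T:
  assumes "u \<in> free_heads D T v"
  shows "v \<in> Domain (parcs T)"
proof -
  have "v \<in> pverts D" using assms by (auto simp: free_heads_def dest: D.in_arcsD1)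
  moreover have "card (free_heads D T v) \<noteq> 0" using assms finite_free_heads by auto
  ultimately show ?thesis
    using greedy_expand_blocked[OF branching_F\<^sub>2, of 1 v vs\<^sub>2] vs(2) unfolding T[symmetric] by simp
qed

text \<open>Passing from \<open>F\<^sub>1\<close> to \<open>F\<^sub>2\<close> adds
  \<open>card I\<close> plus the weight of \<open>I\<close> many arcs and at most
  \<open>card I\<close> internal nodes, so \<open>card I\<close> cancels. The last pass adds at
  least as many arcs as internal nodes, and \<open>T\<close> has fewer arcs than nodes, as heads are
  distinct and never the root.\<close>

lemma internal_bound:
  "card (Domain (parcs T)) + card (parcs F\<^sub>1) + (\<Sum>x \<in> I. card (U x) - 1) + 1
     \<le> card (Domain (parcs F\<^sub>1)) + card (pverts D)"
proof -
  have fin: "finite (parcs F\<^sub>1)" "finite A" "finite (parcs T)"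
    using branching_in_finite[OF branching_F\<^sub>1] branching_in_finite[OF branching_F\<^sub>2]
      branching_in_finite[OF branching_T] by (simp_all add: parcs_F\<^sub>2)
  have "card (parcs F\<^sub>2) = card (parcs F\<^sub>1) + card A"
    unfolding parcs_F\<^sub>2 using fin A_free by (intro card_Un_disjoint) auto
  also have "card A = card I + (\<Sum>x \<in> I. card (U x) - 1)"
  proof -
    \<comment> \<open>Candidate sets have at least two elements, so the subtraction does not
      truncate.\<close>
    have "(\<Sum>x \<in> I. card (U x)) = (\<Sum>x \<in> I. 1 + (card (U x) - 1))"
      using I'(1) card_candidate_set by (intro sum.cong) fastforce+
    then show ?thesis unfolding card_A by (simp only: sum.distrib card_eq_sum)
  qed
  finally have arcs: "card (parcs F\<^sub>2) = card (parcs F\<^sub>1) + (card I + (\<Sum>x \<in> I. card (U x) - 1))" .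
  have "Domain (parcs F\<^sub>2) \<subseteq> Domain (parcs F\<^sub>1) \<union> fst ` I"
    unfolding parcs_F\<^sub>2 A_def by blast
  then have "card (Domain (parcs F\<^sub>2)) \<le> card (Domain (parcs F\<^sub>1) \<union> fst ` I)"
    using finite_I finite_Domain[OF branching_F\<^sub>1] by (intro card_mono) auto
  also have "\<dots> \<le> card (Domain (parcs F\<^sub>1)) + card I"
    using card_Un_le[of "Domain (parcs F\<^sub>1)" "fst ` I"] card_image_le[OF finite_I, of fst] by linarith
  finally have domain: "card (Domain (parcs F\<^sub>2)) \<le> card (Domain (parcs F\<^sub>1)) + card I" .
  have "card (parcs T) + 1 \<le> card (pverts D)"
  proof -
    have "inj_on snd (parcs T)"
      using branching_T by (auto simp: branching_in_def inj_on_def)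
    then have "card (parcs T) = card (Range (parcs T))"
      unfolding Range_snd by (rule card_image[symmetric])
    also have "\<dots> \<le> card (pverts D - {r})"
      using branching_T no_arc_to_root D.pair_finite_verts
      by (intro card_mono) (auto simp: branching_in_def dest: D.in_arcsD2)
    finally have "card (parcs T) + 1 \<le> card (pverts D - {r}) + 1" by simp
    also have "\<dots> = card (pverts D)"
      using card_Suc_Diff1[OF D.pair_finite_verts root_in] by simp
    finally show ?thesis .
  qed
  moreover have "card (Domain (parcs T)) + card (parcs F\<^sub>2) \<le> card (Domain (parcs F\<^sub>2)) + card (parcs T)"
    using expansion_T by (simp add: expansion_def)
  ultimately show ?thesis using arcs domain by linarith
qed

text \<open>An added arc enters a node that had no parent, so in-degrees stay at most one, and every
  node other than the root has a parent in \<open>D\<close> to be attached to. The tails are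
  internal by \<open>blocked_T\<close>, which preserves the set of leaves.\<close>

lemma completion:
  assumes "completes D T T'"
  shows "arborescence T'" "spanning T' D" "Domain (parcs T') = Domain (parcs T)"
proof -
  let ?W = "{u. in_degree T u = 0 \<and> in_degree D u > 0}"
  obtain h where h: "\<And>u. u \<in> ?W \<Longrightarrow> (h u, u) \<in> parcs D"
    and T': "T' = T\<lparr>parcs := parcs T \<union> {(h u, u) | u. u \<in> ?W}\<rparr>"
    using assms unfolding completes_def Let_def by blast
  have W: "u \<in> ?W \<longleftrightarrow> u \<notin> Range (parcs T) \<and> u \<in> Range (parcs D)" for u
    using in_degree_eq_0_iff[OF branching_in_finite[OF branching_T], of u]
      in_degree_eq_0_iff[OF D.pair_finite_arcs, of u] by auto
  have "u \<in> free_heads D T (h u)" if "u \<in> ?W" for u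
    using h[OF that] that by (simp add: free_heads_def)
  then show "Domain (parcs T') = Domain (parcs T)"
    unfolding T' using blocked_T by fastforce
  have "branching_in T'"
    using branching_T h W unfolding branching_in_def T' by auto
  moreover have "v \<in> Range (parcs T')" if "v \<in> pverts D" "v \<noteq> r" for v
    using parent_in_D[OF that] W[of v] unfolding T' by auto
  ultimately show "arborescence T'" "spanning T' D"
    using spanning_arborescenceI by blast+
qed

lemma completed_leaves_bound:
  assumes \<alpha>: "\<alpha> \<ge> 1"
    and opt: "\<And>J. independent (intersection_graph (candidates D F\<^sub>1) U) J \<Longrightarrow>
      1 / \<alpha> * (\<Sum>x \<in> J. real (card (U x) - 1)) \<le> (\<Sum>x \<in> I. real (card (U x) - 1))"
    and T': "completes D T T'" and S: "arborescence S" "spanning S D"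
  shows "1 / max (4 / 3) \<alpha> * real (card (leaves S)) \<le> real (card (leaves T'))"
proof -
  obtain J where J: "independent (intersection_graph (candidates D F\<^sub>1) U) J"
    "card (leaves S) \<le> 1 + card (parcs F\<^sub>1) + (\<Sum>x \<in> J. card (U x) - 1)"
    using leaves_upper_bound[OF branching_F\<^sub>1 saturated_F\<^sub>1 small_F\<^sub>1 S] by blast
  define w where "w = (\<Sum>x \<in> J. real (card (U x) - 1))"
  \<comment> \<open>\<open>b\<close> is the smaller of 3/4 and 1/\<alpha>: the former absorbs the
    arcs of \<open>F\<^sub>1\<close>, the latter the weight. The additive 1 is safe because
    \<open>b\<close> is below 1.\<close>
  define b where "b = 1 / max (4 / 3) \<alpha>"
  have b: "0 \<le> b" "b \<le> 3 / 4" "b \<le> 1 / \<alpha>"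
    using \<alpha> unfolding b_def by (auto simp: field_simps max_def)
  have T'_arcs: "parcs T' \<subseteq> parcs D" "pverts T' = pverts D"
    using completion(2)[OF T'] by (auto simp: spanning_def subgraph_def)
  then have fin: "finite (parcs T')" using D.pair_finite_arcs finite_subset by blast
  have "leaves T' = pverts D - Domain (parcs T)"
    unfolding leaves_eq[OF fin] completion(3)[OF T'] T'_arcs(2) ..
  moreover have "Domain (parcs T) \<subseteq> pverts D"
    using branching_T by (auto simp: branching_in_def dest: D.in_arcsD1)
  ultimately have "card (leaves T') = card (pverts D) - card (Domain (parcs T))"
    "card (Domain (parcs T)) \<le> card (pverts D)"
    using D.pair_finite_verts by (simp_all add: card_Diff_subset finite_subset card_mono)
  then have "1 + card (parcs F\<^sub>1) + (\<Sum>x \<in> I. card (U x) - 1) \<le>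
      card (leaves T') + card (Domain (parcs F\<^sub>1))"
    using internal_bound by linarith
  then have "real (1 + card (parcs F\<^sub>1) + (\<Sum>x \<in> I. card (U x) - 1)) \<le>
      real (card (leaves T') + card (Domain (parcs F\<^sub>1)))"
    by (rule of_nat_mono)
  moreover have "4 * real (card (Domain (parcs F\<^sub>1))) \<le> real (card (parcs F\<^sub>1))"
    using expanded_F\<^sub>1 by linarith
  moreover have "1 / \<alpha> * w \<le> (\<Sum>x \<in> I. real (card (U x) - 1))"
    unfolding w_def by (rule opt) (rule J(1))
  moreover have "b * w \<le> 1 / \<alpha> * w"
    using b(3) unfolding w_def by (intro mult_right_mono sum_nonneg) auto
  moreover have "b * real (card (parcs F\<^sub>1)) \<le> 3 / 4 * real (card (parcs F\<^sub>1))"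
    using b(2) by (intro mult_right_mono) auto
  moreover have "b * real (card (leaves S)) \<le> b * (1 + real (card (parcs F\<^sub>1)) + w)"
  proof (rule mult_left_mono[OF _ b(1)])
    have "real (card (leaves S)) \<le> real (1 + card (parcs F\<^sub>1) + (\<Sum>x \<in> J. card (U x) - 1))"
      using J(2) by (rule of_nat_mono)
    then show "real (card (leaves S)) \<le> 1 + real (card (parcs F\<^sub>1)) + w"
      by (simp add: w_def)
  qed
  ultimately show ?thesis
    using b(2) unfolding b_def[symmetric] by (simp add: algebra_simps)
qed

lemma complete_if_exchange_optimal:
  assumes exchange: "\<And>x y. x \<in> I \<Longrightarrow> y \<in> candidates D F\<^sub>1 - I \<Longrightarrow>
      independent (intersection_graph (candidates D F\<^sub>1) U) (insert y (I - {x})) \<Longrightarrow>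
      card (U y) - 1 \<le> card (U x) - 1"
    and v: "(v, u) \<in> parcs D"
  shows "in_degree T u \<noteq> 0"
proof
  assume "in_degree T u = 0"
  then have u: "u \<in> free_heads D T v" using v by (simp add: free_heads_def)
  have uT: "u \<notin> Range (parcs T)"
    using u free_heads_branching[OF branching_T] by blast
  have u1: "u \<in> free_heads D F\<^sub>1 v"
    using u free_heads_antimono[OF branching_F\<^sub>1 branching_T arcs_T(1)] by blast
  have not_U: "u \<notin> U z" if "z \<in> I" for z
    using that uT arcs_T(2) unfolding parcs_F\<^sub>2 A_def by blast
  \<comment> \<open>A node expanded in the last pass keeps no free head, yet \<open>u\<close> is
    still free for \<open>v\<close>. So \<open>v\<close> became internal earlier, and by the same
    reasoning not in the first pass.\<close>
  have "v \<in> Domain (parcs F\<^sub>2)"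
    using blocked_T[OF u] u expansion_T unfolding expansion_def by blast
  moreover have "v \<notin> Domain (parcs F\<^sub>1)"
    using saturated_F\<^sub>1 u1 by blast
  ultimately obtain x where x: "x \<in> I" "fst x = v"
    unfolding parcs_F\<^sub>2 A_def by blast
  \<comment> \<open>The set of \<open>(v, None)\<close> consists of all free heads and contains
    \<open>u\<close>; so does that of \<open>(v, Some u')\<close> unless \<open>u'\<close> is
    \<open>u\<close>. But \<open>u\<close> is uncovered.\<close>
  obtain u' where "x = (v, Some u')"
    using x not_U[OF x(1)] u1 by (cases x; cases "snd x") auto
  then have x_eq: "x = (v, Some u)" and x3: "card (free_heads D F\<^sub>1 v) = 3" and vD: "v \<in> pverts D"
    and out: "out_degree F\<^sub>1 v = 0"
    using x(1) I'(1) not_U[OF x(1)] u1 unfolding candidates_def by auto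
  let ?y = "(v, None) :: 'a candidate"
  have y: "?y \<in> candidates D F\<^sub>1 - I"
    using x3 vD out not_U[of ?y] u1 unfolding candidates_def by auto
  have Uy: "U ?y = insert u (U x)" using u1 x_eq by auto
  have "disjoint_family_on U (insert ?y (I - {x}))"
    unfolding disjoint_family_on_def
  proof (intro ballI impI)
    have *: "U ?y \<inter> U z = {}" if "z \<in> I - {x}" for z
      using that I'(2) x(1) not_U[of z] unfolding Uy disjoint_family_on_def by blast
    fix z z' assume z: "z \<in> insert ?y (I - {x})" "z' \<in> insert ?y (I - {x})" "z \<noteq> z'"
    then consider "z = ?y" "z' \<in> I - {x}" | "z' = ?y" "z \<in> I - {x}" | "z \<in> I" "z' \<in> I"
      by blast
    then show "U z \<inter> U z' = {}"
      using * I'(2) z(3) unfolding disjoint_family_on_def by cases blast+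
  qed
  then have "independent (intersection_graph (candidates D F\<^sub>1) U) (insert ?y (I - {x}))"
    unfolding independent_candidates using y I'(1) by blast
  \<comment> \<open>The exchange would raise the weight from 1 to 2.\<close>
  from exchange[OF x(1) y this] show False
    using x3 u1 x_eq by (simp add: finite_free_heads)
qed

end

section \<open>The complete program and its guarantee\<close>

text \<open>\<open>A\<close> is trusted on codes of graphs only and cannot enter as a
  \<open>ptime\<close> function, so the conclusion is conditional on an execution within the bound.
  \<open>Fork\<close> keeps the input next to the answer because \<open>h\<close> needs both; the
  size of this pair is bounded by the input size plus the cost of producing it.\<close>

lemma ptime_subroutine:
  fixes p :: "nat poly"
  assumes f: "ptime f" and h: "ptime h"
  shows "\<exists>P. \<exists>q :: nat poly. \<forall>x s t. exec A (f x) s t \<longrightarrow> t \<le> poly p (size (f x)) \<longrightarrow>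
    (\<exists>t'. exec P x (h (Join x s)) t' \<and> t' \<le> poly q (size x))"
proof -
  obtain F S where F: "\<And>x. exec F x (f x) (S x)" and S: "poly_bounded size S"
    using f by (rule ptimeE) blast
  obtain H U where H: "\<And>x. exec H x (h x) (U x)" and U: "poly_bounded size U"
    using h by (rule ptimeE) blast
  obtain u where u: "U x \<le> poly u (size x)" for x
    using U unfolding poly_bounded_def by blast
  define K where "K x = 1 + size x + (1 + size x) + (1 + size x + S x + poly p (size (f x)))" for x
  have "poly_bounded size (\<lambda>x. 1 + size x + K x + poly u (size x + K x))"
    unfolding K_def by (intro poly_bounded_intros S ptime_size[OF f])
  then obtain q where q: "1 + size x + K x + poly u (size x + K x) \<le> poly q (size x)" for x
    unfolding poly_bounded_def by blast
  have "\<exists>t'. exec (Then (Fork Identity (Then F A)) H) x (h (Join x s)) t' \<and> t' \<le> poly q (size x)"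
    if A: "exec A (f x) s t" "t \<le> poly p (size (f x))" for x s t
  proof -
    let ?k = "1 + size x + (1 + size x) + (1 + size x + S x + t)"
    have fork: "exec (Fork Identity (Then F A)) x (Join x s) ?k"
      by (rule exec.Fork[OF exec.Identity exec.Then[OF F A(1)]])
    have k: "?k \<le> K x" using A(2) by (simp add: K_def)
    have "U (Join x s) \<le> poly u (size (Join x s))" by (rule u)
    also have "\<dots> \<le> poly u (size x + K x)"
      using exec_size[OF fork] k by (intro poly_nat_mono) linarith
    finally have "1 + size x + ?k + U (Join x s) \<le> poly q (size x)"
      using k q[of x] by linarith
    with exec.Then[OF fork H] show ?thesis by blast
  qed
  then show ?thesis by blast
qed

text \<open>The choices left open by the pseudocode are fixed here: both passes visit nodes in input
  order, and candidates are enumerated in the order in which the program lists them.\<close>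

lemma maxleaves_12MIS_program:
  assumes A: "approximation_program \<alpha>
      (wMIS :: (nat list \<times> nat weighted_multigraph, nat set) maximization_problem) A"
  shows "\<exists>P. \<exists>q :: nat poly. \<forall>(vs :: 'a list) D. rooted_dag D \<longrightarrow> enumerates vs (pverts D) \<longrightarrow>
    (\<exists>T t. maxleaves_12MIS_completed A D T \<and> exec P (code_digraph vs D) (code_digraph vs T) t \<and>
       t \<le> poly q (size (code_digraph vs D)))"
proof -
  obtain p :: "nat poly" where p: "\<And>V (U :: 'a candidate \<Rightarrow> 'a set) xs.
      hereditary_23_collection V U \<Longrightarrow> enumerates xs V \<Longrightarrow>
      \<exists>I \<subseteq> V. \<exists>t \<le> poly p (size (code_weighted_multigraph xs (intersection_graph V U))).
        exec A (code_weighted_multigraph xs (intersection_graph V U)) (code_subset xs I) t"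
    using approximation_program_time[OF A] by blast
  let ?f = "\<lambda>M. build_graph (positions (items M)) M (first_phase M)"
  let ?h = "\<lambda>z. last_phase (left z) (right z)"
  have "ptime ?f" "ptime ?h"
    by (intro ptime_build_graph ptime_first_phase ptime_last_phase ptime_intros)+
  then obtain P and q :: "nat poly" where P: "\<And>x s t. exec A (?f x) s t \<Longrightarrow>
      t \<le> poly p (size (?f x)) \<Longrightarrow> \<exists>t'. exec P x (?h (Join x s)) t' \<and> t' \<le> poly q (size x)"
    using ptime_subroutine[of ?f ?h A p] by blast
  have "\<exists>T t. maxleaves_12MIS_completed A D T \<and> exec P (code_digraph vs D) (code_digraph vs T) t \<and>
      t \<le> poly q (size (code_digraph vs D))"
    if D: "rooted_dag D" and vs: "enumerates vs (pverts D)" for vs :: "'a list" and D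
  proof -
    have vs': "distinct vs" "pverts D = set vs" using vs by (simp_all add: enumerates_def)
    interpret D: pair_fin_digraph D using D by (simp add: rooted_dag_def)
    interpret enumerated_digraph vs D
      using vs' by unfold_locales (auto dest: D.in_arcsD1 D.in_arcsD2)
    let ?N = "map (name vs) vs" and ?M = "code_digraph vs D"
    define F\<^sub>0 where "F\<^sub>0 = \<lparr>pverts = pverts D, parcs = {}\<rparr>"
    define F\<^sub>1 where "F\<^sub>1 = greedy_expand D 4 vs F\<^sub>0"
    define xs where "xs = candidate_list F\<^sub>1"
    define G where "G = intersection_graph (candidates D F\<^sub>1) (candidate_set D F\<^sub>1)"
    have first: "first_phase ?M = code_digraph vs F\<^sub>1"
      unfolding F\<^sub>1_def F\<^sub>0_def by (rule first_phase_code)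
    have F\<^sub>1: "inside F\<^sub>1"
      unfolding F\<^sub>1_def by (rule greedy_expand_code(2)) (simp add: F\<^sub>0_def inside_def)
    have xs: "enumerates xs (candidates D F\<^sub>1)"
      unfolding xs_def by (rule enumerates_candidate_list[OF vs'(2)])
    have graph: "?f ?M = code_weighted_multigraph xs G"
      unfolding positions_code first G_def xs_def by (rule build_graph_code[OF F\<^sub>1 vs'(2)])
    obtain I t where I: "I \<subseteq> candidates D F\<^sub>1" "t \<le> poly p (size (?f ?M))"
      "exec A (?f ?M) (code_subset xs I) t"
      using p[OF hereditary_candidates[OF vs'(2)] xs] unfolding graph G_def by blast
    obtain t' where t': "exec P ?M (?h (Join ?M (code_subset xs I))) t'" "t' \<le> poly q (size ?M)"
      using P[OF I(3,2)] by blast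
    define F\<^sub>2 where "F\<^sub>2 = F\<^sub>1\<lparr>parcs := parcs F\<^sub>1 \<union>
      {(fst x, u) | x u. x \<in> I \<and> u \<in> candidate_set D F\<^sub>1 x}\<rparr>"
    define T where "T = greedy_expand D 1 vs F\<^sub>2"
    have "fst x \<in> set vs" "u \<in> set vs" if "x \<in> I" "u \<in> candidate_set D F\<^sub>1 x" for x u
      using fst_candidate[of x D F\<^sub>1] that I(1) vs'(2) candidate_set_subset[of F\<^sub>1 x] by blast+
    then have "{(fst x, u) | x u. x \<in> I \<and> u \<in> candidate_set D F\<^sub>1 x} \<subseteq> set vs \<times> set vs"
      by blast
    with F\<^sub>1 have F\<^sub>2: "inside F\<^sub>2"
      unfolding inside_def F\<^sub>2_def by simp
    have "inside T" unfolding T_def by (rule greedy_expand_code(2)[OF F\<^sub>2])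
    then obtain T' where T': "completes D T T'"
      "attach_uncovered ?N ?M (code_digraph vs T) = code_digraph vs T'"
      using attach_uncovered_code by blast
    have "?h (Join ?M (code_subset xs I)) = code_digraph vs T'"
      unfolding left.simps right.simps last_phase_def positions_code first xs_def
        add_selected_code[OF F\<^sub>1 vs'(2) I(1)] F\<^sub>2_def[symmetric]
        greedy_expand_code(1)[OF F\<^sub>2] T_def[symmetric] T'(2) ..
    moreover have "maxleaves_12MIS A D T"
      unfolding maxleaves_12MIS_def
    proof (intro exI conjI)
      show "returns_set A xs G I"
        using I unfolding returns_set_def graph by (auto simp: G_def)
    qed (use vs xs F\<^sub>0_def F\<^sub>1_def G_def F\<^sub>2_def T_def in \<open>simp_all add: G_def\<close>)
    ultimately show ?thesis
      using t' T'(1) unfolding maxleaves_12MIS_completed_def by auto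
  qed
  then show ?thesis by blast
qed

text \<open>\<open>returns_set\<close> alone does not promise independence; it comes from the
  guarantee for the subroutine, and with it every execution meets the assumptions of the counting
  argument.\<close>

lemma maxleaves_12MIS_runE:
  assumes "maxleaves_12MIS A D T" "rooted_dag D"
    and A: "approximation_program \<alpha>
      (wMIS :: (nat list \<times> nat weighted_multigraph, nat set) maximization_problem) A"
    and \<alpha>: "\<alpha> \<ge> 1"
  obtains r vs\<^sub>1 vs\<^sub>2 xs I F\<^sub>1 F\<^sub>2 where "maxleaves_run D r vs\<^sub>1 vs\<^sub>2 I F\<^sub>1 F\<^sub>2 T"
    "hereditary_23_collection (candidates D F\<^sub>1) (candidate_set D F\<^sub>1)"
    "enumerates xs (candidates D F\<^sub>1)"
    "returns_set A xs (intersection_graph (candidates D F\<^sub>1) (candidate_set D F\<^sub>1)) I"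
proof -
  obtain vs\<^sub>1 vs\<^sub>2 xs I F\<^sub>0 F\<^sub>1 F\<^sub>2 G where run:
    "enumerates vs\<^sub>1 (pverts D)" "enumerates vs\<^sub>2 (pverts D)"
    "F\<^sub>0 = \<lparr>pverts = pverts D, parcs = {}\<rparr>" "F\<^sub>1 = greedy_expand D 4 vs\<^sub>1 F\<^sub>0"
    "G = intersection_graph (candidates D F\<^sub>1) (candidate_set D F\<^sub>1)"
    "enumerates xs (wverts G)" "returns_set A xs G I"
    "F\<^sub>2 = F\<^sub>1\<lparr>parcs := parcs F\<^sub>1 \<union> {(fst x, u) | x u. x \<in> I \<and> u \<in> candidate_set D F\<^sub>1 x}\<rparr>"
    "T = greedy_expand D 1 vs\<^sub>2 F\<^sub>2"
    using assms(1) unfolding maxleaves_12MIS_def by blast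
  obtain r where r: "root D r" using assms(2) by (auto simp: rooted_dag_def)
  interpret dag_with_root D r by unfold_locales (fact assms(2) r)+
  interpret enumerated_digraph vs\<^sub>1 D
    using run(1) by unfold_locales (auto simp: enumerates_def dest: D.in_arcsD1 D.in_arcsD2)
  have hereditary: "hereditary_23_collection (candidates D F\<^sub>1) (candidate_set D F\<^sub>1)"
    using run(1) by (intro hereditary_candidates) (simp add: enumerates_def)
  have xs: "enumerates xs (candidates D F\<^sub>1)" using run(5,6) by simp
  have I: "returns_set A xs (intersection_graph (candidates D F\<^sub>1) (candidate_set D F\<^sub>1)) I"
    using run(5,7) by simp
  have "independent (intersection_graph (candidates D F\<^sub>1) (candidate_set D F\<^sub>1)) I"
    by (rule approximation_program_returns(1)[OF A _ hereditary xs I]) (use \<alpha> in simp)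
  then have "maxleaves_run D r vs\<^sub>1 vs\<^sub>2 I F\<^sub>1 F\<^sub>2 T"
    using run(1-4,8,9) by unfold_locales (simp_all add: enumerates_def)
  then show ?thesis using that hereditary xs I by blast
qed

lemma maxleaves_12MIS_completed_approximates:
  assumes "maxleaves_12MIS_completed A D T'" "rooted_dag D"
    and A: "approximation_program \<alpha>
      (wMIS :: (nat list \<times> nat weighted_multigraph, nat set) maximization_problem) A"
    and \<alpha>: "\<alpha> \<ge> 1"
  shows "approximates (max (4 / 3) \<alpha>) max_leaf_spanning_arborescence (vs, D) T'"
proof -
  obtain T where T_run: "maxleaves_12MIS A D T" "completes D T T'"
    using assms(1) unfolding maxleaves_12MIS_completed_def by blast
  obtain r vs\<^sub>1 vs\<^sub>2 xs I F\<^sub>1 F\<^sub>2 where run: "maxleaves_run D r vs\<^sub>1 vs\<^sub>2 I F\<^sub>1 F\<^sub>2 T"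
    "hereditary_23_collection (candidates D F\<^sub>1) (candidate_set D F\<^sub>1)"
    "enumerates xs (candidates D F\<^sub>1)"
    "returns_set A xs (intersection_graph (candidates D F\<^sub>1) (candidate_set D F\<^sub>1)) I"
    by (rule maxleaves_12MIS_runE[OF T_run(1) assms(2) A \<alpha>])
  interpret maxleaves_run D r vs\<^sub>1 vs\<^sub>2 I F\<^sub>1 F\<^sub>2 T by (rule run(1))
  let ?feasible = "{T. arborescence T \<and> spanning T D}"
  let ?values = "(\<lambda>S. real (card (leaves S))) ` ?feasible"
  have T': "T' \<in> ?feasible" using completion[OF T_run(2)] by simp
  \<comment> \<open>Leaf counts are at most the number of nodes, so there are finitely many values
    and the maximum is attained by some arborescence.\<close>
  have "?values \<subseteq> real ` {..card (pverts D)}"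
  proof -
    have "card (leaves S) \<le> card (pverts D)" if "S \<in> ?feasible" for S
      using that spanning_arborescence_parent(1)[of S] D.pair_finite_verts
      by (intro card_mono) (auto simp: leaves_def)
    then show ?thesis by auto
  qed
  then have "finite ?values" by (rule finite_subset) simp
  then have "Max ?values \<in> ?values" using T' by (intro Max_in) auto
  then obtain S where S: "arborescence S" "spanning S D" "Max ?values = real (card (leaves S))"
    by blast
  have "1 / max (4 / 3) \<alpha> * real (card (leaves S)) \<le> real (card (leaves T'))"
  proof (rule completed_leaves_bound[OF \<alpha> _ T_run(2) S(1,2)])
    show "1 / \<alpha> * (\<Sum>x \<in> J. real (card (U x) - 1)) \<le> (\<Sum>x \<in> I. real (card (U x) - 1))"
      if "independent (intersection_graph (candidates D F\<^sub>1) U) J" for J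
      using approximation_program_returns(2)[OF A _ run(2-4) that] \<alpha> by simp
  qed
  moreover have "optimum max_leaf_spanning_arborescence (vs, D) = Max ?values"
    by (simp add: optimum_def max_leaf_spanning_arborescence_def)
  ultimately show ?thesis
    using T' S(3) by (simp add: approximates_def max_leaf_spanning_arborescence_def)
qed

lemma maxleaves_12MIS_exchange_optimal:
  assumes "maxleaves_12MIS A D T" "rooted_dag D"
    and A: "approximation_program \<alpha>
      (wMIS :: (nat list \<times> nat weighted_multigraph, nat set) maximization_problem) A"
    and \<alpha>: "\<alpha> \<ge> 1" and exchange: "exchange_optimal A"
  shows "completes D T T' \<longleftrightarrow> T' = T"
proof -
  obtain r vs\<^sub>1 vs\<^sub>2 xs I F\<^sub>1 F\<^sub>2 where run: "maxleaves_run D r vs\<^sub>1 vs\<^sub>2 I F\<^sub>1 F\<^sub>2 T"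
    "hereditary_23_collection (candidates D F\<^sub>1) (candidate_set D F\<^sub>1)"
    "enumerates xs (candidates D F\<^sub>1)"
    "returns_set A xs (intersection_graph (candidates D F\<^sub>1) (candidate_set D F\<^sub>1)) I"
    by (rule maxleaves_12MIS_runE[OF assms(1,2) A \<alpha>])
  interpret maxleaves_run D r vs\<^sub>1 vs\<^sub>2 I F\<^sub>1 F\<^sub>2 T by (rule run(1))
  have "in_degree T u \<noteq> 0" if "(v, u) \<in> parcs D" for u v
    using exchange_optimal_returns[OF exchange run(2-4)] that
    by (rule complete_if_exchange_optimal)
  then have "in_degree D u = 0" if "in_degree T u = 0" for u
    using that in_degree_eq_0_iff[OF D.pair_finite_arcs, of u] by blast
  then have uncovered: "{u. in_degree T u = 0 \<and> in_degree D u > 0} = {}" by force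
  show ?thesis unfolding completes_def Let_def uncovered by simp
qed

theorem theorem4:
  fixes \<alpha> :: real and A :: prog
  assumes "\<alpha> \<ge> 1"
    and "approximation_program \<alpha>
           (wMIS :: (nat list \<times> nat weighted_multigraph, nat set) maximization_problem) A"
  shows "(exchange_optimal A \<longrightarrow>
           approximation_algorithm (max (4 / 3) \<alpha>)
             (max_leaf_spanning_arborescence ::
               ('a list \<times> 'a pair_pre_digraph, 'a pair_pre_digraph) maximization_problem)
             (\<lambda>(vs, D) T. maxleaves_12MIS A D T)) \<and>
         approximation_algorithm (max (4 / 3) \<alpha>)
           (max_leaf_spanning_arborescence ::
             ('a list \<times> 'a pair_pre_digraph, 'a pair_pre_digraph) maximization_problem)
           (\<lambda>(vs, D) T. maxleaves_12MIS_completed A D T)"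
proof -
  let ?Q = "max_leaf_spanning_arborescence ::
    ('a list \<times> 'a pair_pre_digraph, 'a pair_pre_digraph) maximization_problem"
  have instances: "(vs, D) \<in> instances ?Q \<longleftrightarrow> rooted_dag D \<and> enumerates vs (pverts D)" for vs D
    by (simp add: max_leaf_spanning_arborescence_def)
  have codes: "code_input ?Q (vs, D) = code_digraph vs D"
    "code_output ?Q (vs, D) T = code_digraph vs T" for vs D T
    by (simp_all add: max_leaf_spanning_arborescence_def)
  have completed: "approximation_algorithm (max (4 / 3) \<alpha>) ?Q
      (\<lambda>(vs, D) T. maxleaves_12MIS_completed A D T)"
    unfolding approximation_algorithm_def
  proof (intro conjI ballI allI impI)
    fix i and T :: "'a pair_pre_digraph"
    assume "i \<in> instances ?Q" "(case i of (vs, D) \<Rightarrow> \<lambda>T. maxleaves_12MIS_completed A D T) T"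
    then show "approximates (max (4 / 3) \<alpha>) ?Q i T"
      by (cases i) (simp add: instances maxleaves_12MIS_completed_approximates[OF _ _ assms(2,1)])
  next
    obtain P and p :: "nat poly" where P: "\<And>(vs :: 'a list) D. rooted_dag D \<Longrightarrow>
        enumerates vs (pverts D) \<Longrightarrow> \<exists>T t. maxleaves_12MIS_completed A D T \<and>
          exec P (code_digraph vs D) (code_digraph vs T) t \<and> t \<le> poly p (size (code_digraph vs D))"
      using maxleaves_12MIS_program[OF assms(2)] by metis
    show "\<exists>P. \<exists>p :: nat poly. \<forall>i \<in> instances ?Q. \<exists>T t.
        (case i of (vs, D) \<Rightarrow> \<lambda>T. maxleaves_12MIS_completed A D T) T \<and>
        exec P (code_input ?Q i) (code_output ?Q i T) t \<and> t \<le> poly p (size (code_input ?Q i))"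
    proof (intro exI[of _ P] exI[of _ p] ballI)
      fix i assume "i \<in> instances ?Q"
      then show "\<exists>T t. (case i of (vs, D) \<Rightarrow> \<lambda>T. maxleaves_12MIS_completed A D T) T \<and>
          exec P (code_input ?Q i) (code_output ?Q i T) t \<and> t \<le> poly p (size (code_input ?Q i))"
        using P by (cases i) (simp add: instances codes)
    qed
  qed
  moreover have "approximation_algorithm (max (4 / 3) \<alpha>) ?Q (\<lambda>(vs, D) T. maxleaves_12MIS A D T)"
    if "exchange_optimal A"
  proof -
    \<comment> \<open>There is nothing to attach, so both relations agree on instances, and the
      guarantee together with the program carries over.\<close>
    have "maxleaves_12MIS_completed A D T \<longleftrightarrow> maxleaves_12MIS A D T"
      if "rooted_dag D" for D :: "'a pair_pre_digraph" and T
      using maxleaves_12MIS_exchange_optimal[OF _ that assms(2,1) \<open>exchange_optimal A\<close>]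
      unfolding maxleaves_12MIS_completed_def by metis
    then show ?thesis
      using completed unfolding approximation_algorithm_def
      by (auto simp: max_leaf_spanning_arborescence_def split_beta)
  qed
  ultimately show ?thesis by blast
qed

end
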